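(* Let $k\geq 3$ be an odd integer and let $H\in \mathcal{D}_k\setminus \mathcal{D}_{k-2}$ be a basic tournament. Then the following assertions are equivalent: (i) $H$ is a strong CR tournament. (ii) Every transitive blowup of $H$ is a CR tournament. (iii) For every tournament $T$: $T\in \xi(H)\cap(\mathcal{D}_k\setminus\mathcal{D}_{k-2})$ if and only if $T$ is switching equivalent to a transitive blowup of $H$.
   Context: A tournament is a digraph with exactly one arc between each pair of distinct vertices; an $n$-tournament has $n$ vertices. For distinct vertices $u,v$ of $T$ write $\theta_T(u,v)=1$ if $u\to v$ and $\theta_T(u,v)=-1$ if $v\to u$. The skew-adjacency matrix $S_T=[s_{ij}]$ (w.r.t. a vertex ordering $v_1,\dots,v_n$) has $s_{ij}=1$ if $v_i\to v_j$, $-1$ if $v_j\to v_i$, $0$ if $i=j$; $\det(T)=\det(S_T)$. For nonempty $X\subseteq V(T)$, $T[X]$ is the induced subtournament. For odd $k\geq1$, $\mathcal{D}_k$ is the set of tournaments all of whose subtournaments have determinant at most $k^2$; $\mathcal{D}_{-1}=\emptyset$, and $T\in\mathcal{D}_k\setminus\mathcal{D}_{k-2}$ means $T\in\mathcal{D}_k$, $T\notin\mathcal{D}_{k-2}$. The switch of $T$ with respect to $W\subseteq V(T)$ is obtained by reversing all arcs between $W$ and $V(T)\setminus W$; $T$ and its switches are called switching equivalent. $T_1$ is switching isomorphic to $T_2$ if some switch of $T_1$ is isomorphic to $T_2$. For a tournament $H$, $\xi(H)$ is the set of tournaments containing a subtournament switching isomorphic to $H$. Blowups: if $T$ has vertices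 $v_1,\dots,v_n$ and $H_1,\dots,H_n$ are tournaments, $T(H_1,\dots,H_n)$ replaces each $v_i$ by $H_i$, with $V(H_i)\to V(H_j)$ (all arcs) whenever $v_i\to v_j$. If all $H_i$ are transitive (acyclic) with $|V(H_i)|=a_i$, this is the transitive blowup $T(a_1,\dots,a_n)$; if moreover one $a_i=2$ and all others equal $1$, it is a 1-transitive blowup. "$T$ is switching equivalent to a transitive blowup of $H$" means some switch of $T$ is (isomorphic to) a transitive blowup of $H$. A diamond is a 4-tournament consisting of a 3-cycle together with a vertex dominating all its vertices or dominated by all its vertices. CR notions: two vertices $u_1,u_2$ of $T$ are covertices and also revertices if $|V(T)|=2$; if $|V(T)|\ge3$ they are covertices if $\theta_T(u_1,v)=\theta_T(u_2,v)$ for all $v\ne u_1,u_2$, and revertices if $\theta_T(u_1,v)=-\theta_T(u_2,v)$ for all such $v$; they are CR-associated if they are covertices or revertices. For $u\notin V(T)=\{v_1,\dots,v_n\}$ and $\sigma=(r_1,\dots,r_n)\in\{1,-1\}^n$, $T(u,\sigma)$ is the tournament on $V(T)\cup\{u\}$ extending $T$ with $u\to v_i$ iff $r_i=1$. $u$ is a CR vertex for $T$ with $\sigma$ if some $v\in V(T)$ and $u$ are CR-associated in $T(u,\sigma)$; otherwise $u$ is a non-CR vertex for $T$ with $\sigma$. Let $T\in\mathcal{D}_k\setminus\mathcal{D}_{k-2}$ for an odd $k$. $T$ is a CR tournament if either $T$ is a 1-tournament, a 2-tournament or a diamond, or else for every $u\notin V(T)$ and every $\sigma$ such that $u$ is a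 non-CR vertex for $T$ with $\sigma$, we have $T(u,\sigma)\notin\mathcal{D}_k$. A CR tournament is a strong CR tournament if every 1-transitive blowup of it is a CR tournament. A tournament of order $n\ge4$ is basic if no two of its vertices are CR-associated. *)

theory Defs
  imports
    "Graph_Theory.Graph_Theory"
    "Jordan_Normal_Form.Determinant"
    "HOL-Library.Infinite_Typeclass"
    "HOL-Library.Disjoint_Sets"
begin

section \<open>Tournaments\<close>

locale tournament = pair_digraph T for T :: "'a pair_pre_digraph" +
  assumes nonempty: "pverts T \<noteq> {}"
    and one_arc: "\<And>u v. u \<in> pverts T \<Longrightarrow> v \<in> pverts T \<Longrightarrow> u \<noteq> v \<Longrightarrow>
      ((u, v) \<in> parcs T) \<noteq> ((v, u) \<in> parcs T)"

definition theta :: "'a pair_pre_digraph \<Rightarrow> 'a \<Rightarrow> 'a \<Rightarrow> int" where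
  "theta T u v = (if (u, v) \<in> parcs T then 1 else if (v, u) \<in> parcs T then -1 else 0)"

text \<open>The library's \<^const>\<open>induce_subgraph\<close> leaves the type of pair digraphs; this is its
  restriction to them, see \<open>with_proj_induced\<close> below.\<close>
definition induced :: "'a pair_pre_digraph \<Rightarrow> 'a set \<Rightarrow> 'a pair_pre_digraph" where
  "induced T X = \<lparr> pverts = X, parcs = {(u, v) \<in> parcs T. u \<in> X \<and> v \<in> X} \<rparr>"

lemma with_proj_induced: "with_proj (induced T X) = induce_subgraph (with_proj T) X"
  by (auto simp: with_proj_def induced_def induce_subgraph_def)

abbreviation isomorphic :: "'a pair_pre_digraph \<Rightarrow> 'b pair_pre_digraph \<Rightarrow> bool" where
  "isomorphic T1 T2 \<equiv> digraph_iso (with_proj T1) (with_proj T2)"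


section \<open>Skew-adjacency matrix and determinant\<close>

definition skew_adj :: "'a pair_pre_digraph \<Rightarrow> 'a list \<Rightarrow> int mat" where
  "skew_adj T vs = mat (length vs) (length vs) (\<lambda>(i, j). theta T (vs ! i) (vs ! j))"

text \<open>The chosen vertex ordering is irrelevant, see \<open>tdet_eq\<close>.\<close>
definition tdet :: "'a pair_pre_digraph \<Rightarrow> int" where
  "tdet T = det (skew_adj T (SOME vs. distinct vs \<and> set vs = pverts T))"

text \<open>The guard makes the class empty for \<open>k = -1\<close>.\<close>
definition tclass :: "int \<Rightarrow> 'a pair_pre_digraph set" where
  "tclass k = {T. 1 \<le> k \<and> tournament T \<and>
     (\<forall>X. X \<subseteq> pverts T \<longrightarrow> X \<noteq> {} \<longrightarrow> tdet (induced T X) \<le> k\<^sup>2)}"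


section \<open>Switching\<close>

definition switch :: "'a pair_pre_digraph \<Rightarrow> 'a set \<Rightarrow> 'a pair_pre_digraph" where
  "switch T W = \<lparr> pverts = pverts T,
     parcs = {(u, v). (if (u \<in> W) = (v \<in> W) then (u, v) \<in> parcs T else (v, u) \<in> parcs T)} \<rparr>"

definition switching_isomorphic :: "'a pair_pre_digraph \<Rightarrow> 'b pair_pre_digraph \<Rightarrow> bool" where
  "switching_isomorphic T1 T2 \<longleftrightarrow> (\<exists>W. W \<subseteq> pverts T1 \<and> isomorphic (switch T1 W) T2)"

definition xi :: "'b pair_pre_digraph \<Rightarrow> 'a pair_pre_digraph set" where
  "xi H = {T. tournament T \<and>
     (\<exists>X. X \<subseteq> pverts T \<and> X \<noteq> {} \<and> switching_isomorphic (induced T X) H)}"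


section \<open>Blowups\<close>

text \<open>Meaningful when the vertex sets of the \<open>F v\<close> are pairwise disjoint.\<close>
definition blowup ::
    "'a pair_pre_digraph \<Rightarrow> ('a \<Rightarrow> 'b pair_pre_digraph) \<Rightarrow> 'b pair_pre_digraph" where
  "blowup T F = \<lparr> pverts = (\<Union>v\<in>pverts T. pverts (F v)),
     parcs = (\<Union>v\<in>pverts T. parcs (F v)) \<union> (\<Union>(u, v)\<in>parcs T. pverts (F u) \<times> pverts (F v)) \<rparr>"

definition transitive_tournament :: "'a pair_pre_digraph \<Rightarrow> bool" where
  "transitive_tournament T \<longleftrightarrow> tournament T \<and> acyclic (parcs T)"

definition transitive_parts ::
    "'a pair_pre_digraph \<Rightarrow> ('a \<Rightarrow> 'b pair_pre_digraph) \<Rightarrow> bool" where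
  "transitive_parts T F \<longleftrightarrow> (\<forall>v\<in>pverts T. transitive_tournament (F v)) \<and>
     disjoint_family_on (\<lambda>v. pverts (F v)) (pverts T)"

definition transitive_blowup :: "'a pair_pre_digraph \<Rightarrow> 'b pair_pre_digraph \<Rightarrow> bool" where
  "transitive_blowup T B \<longleftrightarrow> (\<exists>F. transitive_parts T F \<and> B = blowup T F)"

definition one_transitive_blowup :: "'a pair_pre_digraph \<Rightarrow> 'b pair_pre_digraph \<Rightarrow> bool" where
  "one_transitive_blowup T B \<longleftrightarrow> (\<exists>F. transitive_parts T F \<and> B = blowup T F \<and>
     (\<exists>v\<in>pverts T. card (pverts (F v)) = 2 \<and>
        (\<forall>w\<in>pverts T - {v}. card (pverts (F w)) = 1)))"

definition switching_equiv_transitive_blowup ::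
    "'a::infinite pair_pre_digraph \<Rightarrow> 'b pair_pre_digraph \<Rightarrow> bool" where
  "switching_equiv_transitive_blowup T H \<longleftrightarrow>
     (\<exists>W (B :: 'a pair_pre_digraph). W \<subseteq> pverts T \<and> transitive_blowup H B \<and>
        isomorphic (switch T W) B)"


section \<open>CR tournaments\<close>

definition three_cycle :: "'a pair_pre_digraph \<Rightarrow> bool" where
  "three_cycle T \<longleftrightarrow> (\<exists>a b c. distinct [a, b, c] \<and> pverts T = {a, b, c} \<and>
     parcs T = {(a, b), (b, c), (c, a)})"

definition diamond :: "'a pair_pre_digraph \<Rightarrow> bool" where
  "diamond T \<longleftrightarrow> tournament T \<and> card (pverts T) = 4 \<and>
     (\<exists>v\<in>pverts T. three_cycle (induced T (pverts T - {v})) \<and>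
        ((\<forall>w\<in>pverts T - {v}. (v, w) \<in> parcs T) \<or> (\<forall>w\<in>pverts T - {v}. (w, v) \<in> parcs T)))"

text \<open>If there are only two vertices then the conditions on the other vertices are void, so that
  the two vertices are both covertices and revertices.\<close>
definition covertices :: "'a pair_pre_digraph \<Rightarrow> 'a \<Rightarrow> 'a \<Rightarrow> bool" where
  "covertices T u1 u2 \<longleftrightarrow> u1 \<in> pverts T \<and> u2 \<in> pverts T \<and> u1 \<noteq> u2 \<and>
     (\<forall>v\<in>pverts T - {u1, u2}. theta T u1 v = theta T u2 v)"

definition revertices :: "'a pair_pre_digraph \<Rightarrow> 'a \<Rightarrow> 'a \<Rightarrow> bool" where
  "revertices T u1 u2 \<longleftrightarrow> u1 \<in> pverts T \<and> u2 \<in> pverts T \<and> u1 \<noteq> u2 \<and>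
     (\<forall>v\<in>pverts T - {u1, u2}. theta T u1 v = - theta T u2 v)"

definition CR_associated :: "'a pair_pre_digraph \<Rightarrow> 'a \<Rightarrow> 'a \<Rightarrow> bool" where
  "CR_associated T u1 u2 \<longleftrightarrow> covertices T u1 u2 \<or> revertices T u1 u2"

definition extend :: "'a pair_pre_digraph \<Rightarrow> 'a \<Rightarrow> ('a \<Rightarrow> int) \<Rightarrow> 'a pair_pre_digraph" where
  "extend T u \<sigma> = \<lparr> pverts = insert u (pverts T),
     parcs = parcs T \<union> {(u, v) | v. v \<in> pverts T \<and> \<sigma> v = 1}
                     \<union> {(v, u) | v. v \<in> pverts T \<and> \<sigma> v \<noteq> 1} \<rparr>"

definition CR_vertex :: "'a pair_pre_digraph \<Rightarrow> 'a \<Rightarrow> ('a \<Rightarrow> int) \<Rightarrow> bool" where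
  "CR_vertex T u \<sigma> \<longleftrightarrow> (\<exists>v\<in>pverts T. CR_associated (extend T u \<sigma>) v u)"

text \<open>The vertex type must be infinite: otherwise there might be no new vertex \<open>u\<close>, and the
  condition would be void. The \<open>k\<close> below exists and is unique for every tournament, see
  \<open>tclass_unique\<close> and \<open>tclass_exists\<close>.\<close>
definition CR_tournament :: "'a::infinite pair_pre_digraph \<Rightarrow> bool" where
  "CR_tournament T \<longleftrightarrow> (\<exists>k. odd k \<and> T \<in> tclass k - tclass (k - 2) \<and>
     (card (pverts T) = 1 \<or> card (pverts T) = 2 \<or> diamond T \<or>
      (\<forall>u \<sigma>. u \<notin> pverts T \<longrightarrow> \<sigma> \<in> pverts T \<rightarrow> {1, -1} \<longrightarrow> \<not> CR_vertex T u \<sigma> \<longrightarrow>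
         extend T u \<sigma> \<notin> tclass k)))"

definition strong_CR_tournament :: "'a::infinite pair_pre_digraph \<Rightarrow> bool" where
  "strong_CR_tournament T \<longleftrightarrow> CR_tournament T \<and>
     (\<forall>B :: 'a pair_pre_digraph. one_transitive_blowup T B \<longrightarrow> CR_tournament B)"

definition basic :: "'a pair_pre_digraph \<Rightarrow> bool" where
  "basic T \<longleftrightarrow> tournament T \<and> 4 \<le> card (pverts T) \<and>
     \<not> (\<exists>u\<in>pverts T. \<exists>v\<in>pverts T. u \<noteq> v \<and> CR_associated T u v)"


section \<open>Well-definedness\<close>

lemma det_skew_adj_eq:
  assumes vs: "distinct vs" and ws: "distinct ws" and eq: "set vs = set ws"
  shows "det (skew_adj T vs) = det (skew_adj T ws)"
proof -
  define n where "n = length vs"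
  have len: "length ws = n"
    using assms by (metis distinct_card n_def)
  obtain q where q: "q permutes {..<length ws}" and vsq: "permute_list q ws = vs"
    using mset_eq_permutation[of vs ws] assms set_eq_iff_mset_eq_distinct by metis
  have q': "q permutes {0..<n}"
    using q len by (simp add: lessThan_atLeast0)
  have nth: "vs ! i = ws ! q i" if "i < n" for i
    using permute_list_nth[OF q, of i] that vsq len by simp
  define A where "A = skew_adj T ws"
  have A: "A \<in> carrier_mat n n"
    by (simp add: A_def skew_adj_def len)
  define B where "B = mat n n (\<lambda>(i, j). A $$ (q i, j))"
  have B: "B \<in> carrier_mat n n"
    by (simp add: B_def)
  have qn: "q i < n" if "i < n" for i
    using that permutes_in_image[OF q', of i] by simp
  have BT: "transpose_mat B \<in> carrier_mat n n"
    using B by simp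
  have "skew_adj T vs = transpose_mat (mat n n (\<lambda>(i, j). transpose_mat B $$ (q i, j)))"
    by (rule eq_matI) (auto simp: skew_adj_def B_def A_def nth qn len n_def[symmetric])
  then have "det (skew_adj T vs) = det (mat n n (\<lambda>(i, j). transpose_mat B $$ (q i, j)))"
    by (simp add: det_transpose[of _ n])
  also have "\<dots> = signof q * det (transpose_mat B)"
    by (rule det_permute_rows[OF BT q'])
  also have "det (transpose_mat B) = det B"
    by (rule det_transpose[OF B])
  also have "det B = signof q * det A"
    unfolding B_def by (rule det_permute_rows[OF A q'])
  finally show ?thesis
    by (simp add: A_def sign_def)
qed

lemma tdet_eq:
  assumes "distinct vs" "set vs = pverts T"
  shows "tdet T = det (skew_adj T vs)"
proof -
  have "\<exists>vs. distinct vs \<and> set vs = pverts T"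
    using assms by blast
  from someI_ex[OF this] show ?thesis
    unfolding tdet_def using assms by (intro det_skew_adj_eq) auto
qed

lemma tclass_mono:
  assumes "k \<le> l" shows "tclass k \<subseteq> tclass l"
proof
  fix T :: "'a pair_pre_digraph"
  assume T: "T \<in> tclass k"
  then have "k\<^sup>2 \<le> l\<^sup>2"
    using assms by (auto simp: tclass_def intro: power_mono)
  with T assms show "T \<in> tclass l"
    unfolding tclass_def mem_Collect_eq by (meson order_trans)
qed

lemma tclass_unique:
  assumes "odd k" "odd l" "T \<in> tclass k - tclass (k - 2)" "T \<in> tclass l - tclass (l - 2)"
  shows "k = l"
proof -
  have "False" if "a < b" "odd a" "odd b" "T \<in> tclass a" "T \<notin> tclass (b - 2)" for a b :: int
  proof -
    have "a \<le> b - 2"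
      using that by presburger
    then show False
      using tclass_mono that by blast
  qed
  then show ?thesis
    using assms by (metis DiffD1 DiffD2 linorder_neqE)
qed

lemma tclass_exists:
  assumes "tournament T"
  shows "\<exists>k. odd k \<and> T \<in> tclass k - tclass (k - 2)"
proof -
  interpret tournament T by fact
  define M where "M = Max ((\<lambda>X. \<bar>tdet (induced T X)\<bar>) ` Pow (pverts T))"
  have le: "tdet (induced T X) \<le> M" if "X \<subseteq> pverts T" for X
  proof -
    have "\<bar>tdet (induced T X)\<bar> \<le> M"
      unfolding M_def using that pair_finite_verts by (intro Max_ge) auto
    then show ?thesis by simp
  qed
  define P where "P n \<longleftrightarrow> T \<in> tclass (2 * int n + 1)" for n
  have "P (nat M)"
  proof -
    have "M \<le> (2 * int (nat M) + 1)\<^sup>2"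
      using self_le_power[of "2 * int (nat M) + 1" 2] by linarith
    then have "tdet (induced T X) \<le> (2 * int (nat M) + 1)\<^sup>2" if "X \<subseteq> pverts T" for X
      using le[OF that] by linarith
    then show ?thesis
      using assms by (simp add: P_def tclass_def)
  qed
  define n where "n = (LEAST n. P n)"
  have Pn: "P n"
    unfolding n_def by (rule LeastI) fact
  have "T \<notin> tclass (2 * int n + 1 - 2)"
  proof (cases n)
    case 0
    then show ?thesis by (simp add: tclass_def)
  next
    case (Suc m)
    then have "\<not> P m"
      using not_less_Least[of m P] by (simp add: n_def)
    then show ?thesis
      using Suc by (simp add: P_def algebra_simps)
  qed
  with Pn show ?thesis
    by (intro exI[of _ "2 * int n + 1"]) (auto simp: P_def)
qed

lemma isomorphic_iff:
  assumes "tournament T1" "tournament T2"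
  shows "isomorphic T1 T2 \<longleftrightarrow> (\<exists>f. bij_betw f (pverts T1) (pverts T2) \<and>
    (\<forall>u\<in>pverts T1. \<forall>v\<in>pverts T1. (u, v) \<in> parcs T1 \<longleftrightarrow> (f u, f v) \<in> parcs T2))"
    (is "_ \<longleftrightarrow> ?R")
proof
  interpret T1: tournament T1 by fact
  interpret T2: tournament T2 by fact
  show ?R if iso: "isomorphic T1 T2"
  proof -
    obtain h where h: "T1.digraph_isomorphism h" "with_proj T2 = app_iso h (with_proj T1)"
      using iso unfolding digraph_iso_def by auto
    let ?f = "iso_verts h"
    have V: "pverts T2 = ?f ` pverts T1" and A: "parcs T2 = iso_arcs h ` parcs T1"
      and t: "iso_tail h = fst" "iso_head h = snd"
      using h(2) by (metis verts_app_iso arcs_app_iso tail_app_iso head_app_iso with_proj_simps)+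
    have inj: "inj_on ?f (pverts T1)"
      using T1.digraph_isomorphism_inj_on_verts[OF h(1)] by simp
    have e: "iso_arcs h (u, v) = (?f u, ?f v)" if "(u, v) \<in> parcs T1" for u v
      using T1.iso_verts_tail[OF h(1), of "(u, v)"] T1.iso_verts_head[OF h(1), of "(u, v)"] that t
      by (simp add: prod_eq_iff)
    have "(u, v) \<in> parcs T1 \<longleftrightarrow> (?f u, ?f v) \<in> parcs T2"
      if "u \<in> pverts T1" "v \<in> pverts T1" for u v
    proof
      assume "(u, v) \<in> parcs T1"
      then show "(?f u, ?f v) \<in> parcs T2" using A e by force
    next
      assume "(?f u, ?f v) \<in> parcs T2"
      then obtain a b where ab: "(a, b) \<in> parcs T1" "(?f u, ?f v) = (?f a, ?f b)"
        using A e by force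
      then have "u = a" "v = b"
        using inj that T1.in_arcsD1 T1.in_arcsD2 by (auto dest: inj_onD)
      then show "(u, v) \<in> parcs T1" using ab by simp
    qed
    then show ?R using V inj by (auto simp: bij_betw_def)
  qed
  show "isomorphic T1 T2" if ?R
  proof -
    from that obtain f where f: "bij_betw f (pverts T1) (pverts T2)"
      "\<And>u v. u \<in> pverts T1 \<Longrightarrow> v \<in> pverts T1 \<Longrightarrow> (u, v) \<in> parcs T1 \<longleftrightarrow> (f u, f v) \<in> parcs T2"
      by blast
    let ?h = "\<lparr> iso_verts = f, iso_arcs = map_prod f f, iso_head = snd, iso_tail = fst \<rparr>"
    have inj: "inj_on f (pverts T1)" using f(1) by (simp add: bij_betw_def)
    have sub: "parcs T1 \<subseteq> pverts T1 \<times> pverts T1"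
      using T1.in_arcsD1 T1.in_arcsD2 by auto
    have "inj_on (map_prod f f) (parcs T1)"
      using inj_on_subset[OF map_prod_inj_on[OF inj inj] sub] .
    then have 1: "T1.digraph_isomorphism ?h"
      using inj T1.wf_digraph_axioms by (auto simp: T1.digraph_isomorphism_def)
    have img: "map_prod f f ` parcs T1 = parcs T2"
    proof (intro subset_antisym subrelI)
      fix x y assume "(x, y) \<in> map_prod f f ` parcs T1"
      then show "(x, y) \<in> parcs T2" using sub f(2) by auto
    next
      fix x y assume xy: "(x, y) \<in> parcs T2"
      then obtain u v where "u \<in> pverts T1" "v \<in> pverts T1" "x = f u" "y = f v"
        using T2.in_arcsD1 T2.in_arcsD2 f(1) by (metis bij_betw_imp_surj_on imageE)
      then show "(x, y) \<in> map_prod f f ` parcs T1" using f(2) xy by force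
    qed
    have "with_proj T2 = app_iso ?h (with_proj T1)"
      using f(1) img by (simp add: app_iso_def with_proj_def bij_betw_def)
    with 1 show ?thesis unfolding digraph_iso_def by blast
  qed
qed

end

theory Submission
  imports Defs
begin

text \<open>Two CR-associated vertices can be deleted without changing the determinant, so blowing up and
  switching do not leave \<open>D\<^sub>k\<close>. Let \<open>u\<close> extend a transitive blowup \<open>B\<close> of \<open>H\<close> within \<open>D\<^sub>k\<close>.

  If \<open>H\<close> is strong CR, then \<open>u\<close> agrees up to a sign with a vertex \<open>q\<close> of \<open>H\<close> on a
  transversal of the parts; \<open>q\<close> and the sign are unique as \<open>H\<close> is basic. Adding to the
  transversal one more vertex gives a 1-transitive blowup, which forces the same \<open>q\<close> and sign
  there. Two vertices in the part of \<open>q\<close> show that \<open>u\<close> fits into its linear order, next to a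
  vertex to which it is CR-associated.

  If all blowups are CR, a switched blowup inside \<open>T\<close> grows vertex by vertex, since every new
  vertex is a covertex of an old one after possibly switching it.

  Conversely, if \<open>B\<close> together with \<open>u\<close> switches to a blowup of \<open>H\<close>, then either \<open>u\<close> shares
  its part and has a covertex there, or a copy of \<open>H\<close> in \<open>B\<close> meets some part twice, by the
  pigeonhole principle, and so has two CR-associated vertices.\<close>

section \<open>Tournaments through their signs\<close>

text \<open>Finiteness of the arc set does not appear on the right because arcs are pairs from the
  finite vertex set.\<close>

lemma tournament_iff:
  "tournament T \<longleftrightarrow> finite (pverts T) \<and> pverts T \<noteq> {} \<and>
    (\<forall>u v. (u, v) \<in> parcs T \<longrightarrow> u \<in> pverts T \<and> v \<in> pverts T \<and> u \<noteq> v) \<and>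
    (\<forall>u\<in>pverts T. \<forall>v\<in>pverts T. u \<noteq> v \<longrightarrow> ((u, v) \<in> parcs T) \<noteq> ((v, u) \<in> parcs T))"
    (is "_ \<longleftrightarrow> ?R")
proof
  assume "tournament T"
  then interpret tournament T .
  show ?R
    using pair_finite_verts nonempty one_arc no_loops' in_arcsD1 in_arcsD2 by blast
next
  assume R: ?R
  then have "finite (parcs T)"
    by (intro finite_subset[of "parcs T" "pverts T \<times> pverts T"]) auto
  moreover have "fst e \<in> pverts T" "snd e \<in> pverts T" "fst e \<noteq> snd e" if "e \<in> parcs T" for e
    using R that by (metis prod.collapse)+
  ultimately show "tournament T"
    using R by unfold_locales blast+
qed

lemma tournament_arcD:
  assumes "tournament T" "(u, v) \<in> parcs T"
  shows "u \<in> pverts T" "v \<in> pverts T" "u \<noteq> v" "(v, u) \<notin> parcs T"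
  using assms unfolding tournament_iff by blast+

lemma tournament_arc_cases:
  assumes "tournament T" "u \<in> pverts T" "v \<in> pverts T" "u \<noteq> v"
  shows "(u, v) \<in> parcs T \<or> (v, u) \<in> parcs T"
  using assms unfolding tournament_iff by blast

lemma tournamentI:
  assumes "finite (pverts T)" "pverts T \<noteq> {}"
    and "\<And>u v. (u, v) \<in> parcs T \<Longrightarrow> u \<in> pverts T \<and> v \<in> pverts T \<and> u \<noteq> v \<and> (v, u) \<notin> parcs T"
    and "\<And>u v. u \<in> pverts T \<Longrightarrow> v \<in> pverts T \<Longrightarrow> u \<noteq> v \<Longrightarrow> (u, v) \<in> parcs T \<or> (v, u) \<in> parcs T"
  shows "tournament T"
  unfolding tournament_iff using assms by meson

lemma tournament_finite: "tournament T \<Longrightarrow> finite (pverts T)"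
  and tournament_nonempty: "tournament T \<Longrightarrow> pverts T \<noteq> {}"
  by (simp_all add: tournament_iff)

lemma theta_eq_1_iff: "theta T u v = 1 \<longleftrightarrow> (u, v) \<in> parcs T"
  by (simp add: theta_def)

lemma theta_self: "tournament T \<Longrightarrow> theta T u u = 0"
  by (auto simp: theta_def dest: tournament_arcD)

lemma theta_antisym: "tournament T \<Longrightarrow> theta T v u = - theta T u v"
  by (auto simp: theta_def dest: tournament_arcD)

lemma theta_cases:
  "tournament T \<Longrightarrow> u \<in> pverts T \<Longrightarrow> v \<in> pverts T \<Longrightarrow> u \<noteq> v \<Longrightarrow> theta T u v = 1 \<or> theta T u v = -1"
  by (auto simp: theta_def dest: tournament_arc_cases)

lemma theta_outside:
  "tournament T \<Longrightarrow> u \<notin> pverts T \<or> v \<notin> pverts T \<Longrightarrow> theta T u v = 0"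
  by (auto simp: theta_def dest: tournament_arcD)

text \<open>Both signs vanish outside the common vertex set, so agreement on it extends to all pairs
  and fixes the arcs.\<close>

lemma tournament_eqI:
  assumes "tournament S" "tournament T" "pverts S = pverts T"
    and "\<And>u v. u \<in> pverts S \<Longrightarrow> v \<in> pverts S \<Longrightarrow> theta S u v = theta T u v"
  shows "S = T"
proof -
  have "theta S u v = theta T u v" for u v
    using assms theta_outside by metis
  then have "parcs S = parcs T"
    by (auto simp: theta_eq_1_iff[symmetric])
  then show ?thesis
    using assms(3) by simp
qed

lemma pverts_induced [simp]: "pverts (induced T X) = X"
  by (simp add: induced_def)

lemma induced_all: "tournament T \<Longrightarrow> induced T (pverts T) = T"
  using tournament_arcD(1,2) by (cases T) (fastforce simp: induced_def)

lemma theta_induced: "u \<in> X \<Longrightarrow> v \<in> X \<Longrightarrow> theta (induced T X) u v = theta T u v"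
  by (simp add: theta_def induced_def)

lemma tournament_induced:
  assumes T: "tournament T" and X: "X \<subseteq> pverts T" "X \<noteq> {}"
  shows "tournament (induced T X)"
  using X tournament_finite[OF T]
  by (intro tournamentI)
    (auto simp: induced_def subset_iff intro: finite_subset
      dest: tournament_arcD(3,4)[OF T] tournament_arc_cases[OF T])

lemma pverts_switch [simp]: "pverts (switch T W) = pverts T"
  by (simp add: switch_def)

text \<open>The diagonal of the sign matrix by which switching conjugates the skew-adjacency matrix;
  see \<open>theta_switch\<close>.\<close>

definition switch_sign :: "'a set \<Rightarrow> 'a \<Rightarrow> int" where
  "switch_sign W u = (if u \<in> W then -1 else 1)"

lemma tournament_switch:
  assumes T: "tournament T"
  shows "tournament (switch T W)"
  using tournament_finite[OF T] tournament_nonempty[OF T] tournament_arcD[OF T] tournament_arc_cases[OF T]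
  by (intro tournamentI) (auto simp: switch_def split: if_splits)

lemma theta_switch:
  "tournament T \<Longrightarrow> theta (switch T W) u v = switch_sign W u * switch_sign W v * theta T u v"
  by (auto simp: theta_def switch_def switch_sign_def dest: tournament_arcD(4))

lemma pverts_extend [simp]: "pverts (extend T u \<sigma>) = insert u (pverts T)"
  by (simp add: extend_def)

lemma tournament_extend:
  assumes T: "tournament T" and u: "u \<notin> pverts T"
  shows "tournament (extend T u \<sigma>)"
  using u tournament_finite[OF T] tournament_arc_cases[OF T]
  by (intro tournamentI) (auto simp: extend_def dest: tournament_arcD[OF T])

lemma theta_extend:
  assumes "tournament T" "u \<notin> pverts T"
  shows "v \<in> pverts T \<Longrightarrow> w \<in> pverts T \<Longrightarrow> theta (extend T u \<sigma>) v w = theta T v w"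
    and "\<sigma> \<in> pverts T \<rightarrow> {1, -1} \<Longrightarrow> w \<in> pverts T \<Longrightarrow> theta (extend T u \<sigma>) u w = \<sigma> w"
    and "\<sigma> \<in> pverts T \<rightarrow> {1, -1} \<Longrightarrow> w \<in> pverts T \<Longrightarrow> theta (extend T u \<sigma>) w u = - \<sigma> w"
  using assms(2) tournament_arcD(1,2)[OF assms(1)] by (auto simp: theta_def extend_def)

text \<open>One sign treats both kinds at once: 1 stands for covertices and -1 for
  revertices.\<close>

lemma CR_associated_iff:
  "CR_associated T u v \<longleftrightarrow> u \<in> pverts T \<and> v \<in> pverts T \<and> u \<noteq> v \<and>
    (\<exists>\<epsilon>\<in>{1, -1}. \<forall>w\<in>pverts T - {u, v}. theta T u w = \<epsilon> * theta T v w)"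
  by (auto simp: CR_associated_def covertices_def revertices_def)

text \<open>Since \<open>\<sigma>\<close> is the row of signs of \<open>u\<close>, the condition can
  be read inside \<open>T\<close>. The sign moves across the equation because its square is
  1.\<close>

lemma CR_vertex_iff:
  assumes T: "tournament T" "u \<notin> pverts T" and \<sigma>: "\<sigma> \<in> pverts T \<rightarrow> {1, -1}"
  shows "CR_vertex T u \<sigma> \<longleftrightarrow>
    (\<exists>v\<in>pverts T. \<exists>\<epsilon>\<in>{1, -1}. \<forall>w\<in>pverts T - {v}. \<sigma> w = \<epsilon> * theta T v w)"
proof -
  have eq: "insert u (pverts T) - {v, u} = pverts T - {v}" for v
    using T(2) by auto
  have "CR_associated (extend T u \<sigma>) v u \<longleftrightarrow>
      (\<exists>\<epsilon>\<in>{1, -1}. \<forall>w\<in>pverts T - {v}. \<sigma> w = \<epsilon> * theta T v w)" if v: "v \<in> pverts T" for v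
  proof -
    have "theta (extend T u \<sigma>) v w = theta T v w" "theta (extend T u \<sigma>) u w = \<sigma> w"
      if "w \<in> pverts T - {v}" for w
      using theta_extend[OF T] that v \<sigma> by auto
    moreover have "v \<noteq> u"
      using v T(2) by auto
    moreover have "theta T v w = \<epsilon> * \<sigma> w \<longleftrightarrow> \<sigma> w = \<epsilon> * theta T v w" if "\<epsilon> \<in> {1, -1}" for \<epsilon> w
      using that by auto
    ultimately show ?thesis
      unfolding CR_associated_iff pverts_extend eq using v by simp
  qed
  then show ?thesis
    by (simp add: CR_vertex_def)
qed


section \<open>Determinants\<close>

text \<open>\<open>B\<close> is \<open>A\<close> conjugated by the diagonal matrix of the signs
  \<open>d\<close>. In the Leibniz expansion each sign enters every product twice, once through its
  row and once through its column.\<close>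

lemma det_signed:
  fixes A B :: "int mat"
  assumes A: "A \<in> carrier_mat n n" and B: "B \<in> carrier_mat n n"
    and d: "\<And>i. i < n \<Longrightarrow> d i = 1 \<or> d i = -1"
    and eq: "\<And>i j. i < n \<Longrightarrow> j < n \<Longrightarrow> B $$ (i, j) = d i * d j * A $$ (i, j)"
  shows "det B = det A"
proof -
  have "(\<Prod>i = 0..<n. B $$ (i, p i)) = (\<Prod>i = 0..<n. A $$ (i, p i))"
    if p: "p permutes {0..<n}" for p
  proof -
    have "(\<Prod>i = 0..<n. B $$ (i, p i)) = (\<Prod>i = 0..<n. d i * d (p i) * A $$ (i, p i))"
      using permutes_in_image[OF p] by (intro prod.cong) (auto simp: eq)
    also have "\<dots> = (\<Prod>i = 0..<n. d i) * (\<Prod>i = 0..<n. d (p i)) * (\<Prod>i = 0..<n. A $$ (i, p i))"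
      by (simp add: prod.distrib)
    also have "(\<Prod>i = 0..<n. d (p i)) = (\<Prod>i = 0..<n. d i)"
      using prod.permute[OF p, of d] by simp
    also have "(\<Prod>i = 0..<n. d i) * (\<Prod>i = 0..<n. d i) = 1"
      unfolding prod.distrib[symmetric] using d by (intro prod.neutral) force
    finally show ?thesis by simp
  qed
  then show ?thesis
    unfolding det_def'[OF A] det_def'[OF B] by (intro sum.cong) auto
qed

text \<open>Combines invariance under isomorphism (\<open>s\<close> constantly 1) with invariance
  under switching (\<open>f\<close> the identity).\<close>

lemma tdet_signed_bij:
  assumes f: "bij_betw f (pverts S) (pverts T)" and fin: "finite (pverts S)"
    and s: "\<And>x. x \<in> pverts S \<Longrightarrow> s x = 1 \<or> s x = -1"
    and eq: "\<And>x y. x \<in> pverts S \<Longrightarrow> y \<in> pverts S \<Longrightarrow>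
      theta S x y = s x * s y * theta T (f x) (f y)"
  shows "tdet S = tdet T"
proof -
  obtain vs where vs: "distinct vs" "set vs = pverts S"
    using finite_distinct_list[OF fin] by auto
  have 1: "tdet S = det (skew_adj S vs)"
    by (rule tdet_eq[OF vs])
  have 2: "tdet T = det (skew_adj T (map f vs))"
    using f vs by (intro tdet_eq) (auto simp: bij_betw_def distinct_map)
  have mem: "vs ! i \<in> pverts S" if "i < length vs" for i
    using that vs(2) nth_mem by metis
  have "det (skew_adj S vs) = det (skew_adj T (map f vs))"
    by (rule det_signed[where n = "length vs" and d = "\<lambda>i. s (vs ! i)"])
      (auto simp: skew_adj_def s mem eq)
  then show ?thesis
    using 1 2 by simp
qed

text \<open>Laplace expansion along row 0 leaves the entry at \<open>(0, 1)\<close>, whose cofactor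
  carries the minus sign. Expanding the minor along column 0 then leaves the entry at
  \<open>(1, 0)\<close>.\<close>

lemma det_corner_block:
  fixes B :: "int mat"
  assumes B: "B \<in> carrier_mat (n + 2) (n + 2)"
    and row: "\<And>j. j < n + 2 \<Longrightarrow> j \<noteq> 1 \<Longrightarrow> B $$ (0, j) = 0"
    and col: "\<And>i. i < n + 2 \<Longrightarrow> i \<noteq> 1 \<Longrightarrow> B $$ (i, 0) = 0"
  shows "det B = - (B $$ (0, 1) * B $$ (1, 0)) * det (mat n n (\<lambda>(i, j). B $$ (i + 2, j + 2)))"
proof -
  let ?C = "mat_delete B 0 1"
  have C: "?C \<in> carrier_mat (n + 1) (n + 1)"
    using mat_delete_carrier[of B "n + 2" "n + 2"] B by simp
  have "det B = (\<Sum>j<n + 2. B $$ (0, j) * cofactor B 0 j)"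
    by (rule laplace_expansion_row[OF B]) simp
  also have "\<dots> = (\<Sum>j\<in>{1}. B $$ (0, j) * cofactor B 0 j)"
    using row by (intro sum.mono_neutral_right) auto
  finally have 1: "det B = - (B $$ (0, 1) * det ?C)"
    by (simp add: cofactor_def)
  have C0: "?C $$ (i, 0) = (if i = 0 then B $$ (1, 0) else 0)" if "i < n + 1" for i
    using that B col[of "Suc i"] by (simp add: mat_delete_def)
  have "det ?C = (\<Sum>i<n + 1. ?C $$ (i, 0) * cofactor ?C i 0)"
    by (rule laplace_expansion_column[OF C]) simp
  also have "\<dots> = (\<Sum>i\<in>{0}. ?C $$ (i, 0) * cofactor ?C i 0)"
    using C0 by (intro sum.mono_neutral_right) auto
  also have "\<dots> = B $$ (1, 0) * det (mat_delete ?C 0 0)"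
    using C0[of 0] by (simp add: cofactor_def)
  also have "mat_delete ?C 0 0 = mat n n (\<lambda>(i, j). B $$ (i + 2, j + 2))"
    using B by (intro eq_matI) (auto simp: mat_delete_def)
  finally show ?thesis
    using 1 by simp
qed

text \<open>Adding \<open>-\<epsilon>\<close> times row and column \<open>v\<close> to row and column \<open>u\<close> isolates a block
  with determinant 1. The determinant of the empty digraph is \<open>1\<close>.\<close>
lemma tdet_CR_associated:
  assumes T: "tournament T" and CR: "CR_associated T u v"
  shows "tdet T = tdet (induced T (pverts T - {u, v}))"
proof -
  obtain \<epsilon> where uv: "u \<in> pverts T" "v \<in> pverts T" "u \<noteq> v" and e: "\<epsilon> \<in> {1, -1}"
    and eq: "\<And>w. w \<in> pverts T - {u, v} \<Longrightarrow> theta T u w = \<epsilon> * theta T v w"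
    using CR unfolding CR_associated_iff by blast
  obtain ws where ws: "distinct ws" "set ws = pverts T - {u, v}"
    using finite_distinct_list[of "pverts T - {u, v}"] tournament_finite[OF T] by auto
  define n where "n = length ws"
  \<comment> \<open>\<open>u\<close> and \<open>v\<close> are listed first so that the pair fills
    rows and columns 0 and 1, as \<open>det_corner_block\<close> expects.\<close>
  define A where "A = skew_adj T (u # v # ws)"
  have A: "A \<in> carrier_mat (n + 2) (n + 2)"
    by (simp add: A_def skew_adj_def n_def)
  define B where "B = addcol (- \<epsilon>) 0 1 (addrow (- \<epsilon>) 0 1 A)"
  have B: "B \<in> carrier_mat (n + 2) (n + 2)"
    using carrier_matD[OF A] by (intro carrier_matI) (simp_all add: B_def)
  have detB: "det B = det A"
    unfolding B_def using A by (subst det_addcol[where n = "n + 2"]) (auto intro: det_addrow)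
  have Aent: "A $$ (i, j) = theta T ((u # v # ws) ! i) ((u # v # ws) ! j)"
    if "i < n + 2" "j < n + 2" for i j
    using that by (simp add: A_def skew_adj_def n_def)
  have Bent: "B $$ (i, j) = (let R = (\<lambda>j. if i = 0 then - \<epsilon> * A $$ (1, j) + A $$ (0, j) else A $$ (i, j))
      in if j = 0 then - \<epsilon> * R 1 + R 0 else R j)"
    if "i < n + 2" "j < n + 2" for i j
    using that A by (auto simp: B_def Let_def)
  have nth: "ws ! i \<in> pverts T - {u, v}" if "i < n" for i
    using that ws by (metis n_def nth_mem)
  have ee: "\<epsilon> * \<epsilon> = 1"
    using e by auto
  \<comment> \<open>For \<open>j\<close> from 2 on the entry vanishes because the signs of
    \<open>u\<close> and \<open>v\<close> are proportional there. At \<open>j = 0\<close> two terms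
    remain, which cancel by antisymmetry.\<close>
  have row: "B $$ (0, j) = 0" if "j < n + 2" "j \<noteq> 1" for j
  proof (cases "j = 0")
    case True
    then show ?thesis
      using theta_antisym[OF T, of v u] theta_self[OF T] by (simp add: Bent Aent)
  next
    case False
    then obtain i where "j = Suc (Suc i)" "i < n"
      using \<open>j \<noteq> 1\<close> \<open>j < n + 2\<close> by (metis One_nat_def add_2_eq_Suc' not0_implies_Suc Suc_less_eq)
    then show ?thesis
      using eq[OF nth] by (simp add: Bent Aent)
  qed
  have col: "B $$ (i, 0) = 0" if "i < n + 2" "i \<noteq> 1" for i
  proof (cases "i = 0")
    case True
    then show ?thesis using row[of 0] by simp
  next
    case False
    then obtain j where "i = Suc (Suc j)" "j < n"
      using \<open>i \<noteq> 1\<close> \<open>i < n + 2\<close> by (metis One_nat_def add_2_eq_Suc' not0_implies_Suc Suc_less_eq)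
    then show ?thesis
      using eq[OF nth] theta_antisym[OF T, of "ws ! j"] by (simp add: Bent Aent)
  qed
  have B01: "B $$ (0, 1) = theta T u v" "B $$ (1, 0) = - theta T u v"
    using theta_self[OF T] theta_antisym[OF T, of v u] by (simp_all add: Bent Aent)
  have block: "mat n n (\<lambda>(i, j). B $$ (i + 2, j + 2)) = skew_adj (induced T (pverts T - {u, v})) ws"
    using nth by (intro eq_matI) (auto simp: Bent Aent skew_adj_def n_def theta_induced)
  have sq: "theta T u v * theta T u v = 1"
    using theta_cases[OF T uv] by auto
  have "tdet T = det A"
    unfolding A_def using ws uv by (intro tdet_eq) auto
  also have "\<dots> = det (skew_adj (induced T (pverts T - {u, v})) ws)"
    using detB det_corner_block[OF B row col] by (simp only: block B01) (simp add: sq)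
  also have "\<dots> = tdet (induced T (pverts T - {u, v}))"
    using ws by (intro tdet_eq[symmetric]) auto
  finally show ?thesis .
qed

section \<open>Classes of bounded determinant\<close>

lemma tdet_empty: "tdet (induced T {}) = 1"
  using tdet_eq[of "[]" "induced T {}"] by (simp add: skew_adj_def)

lemma tclassD:
  "T \<in> tclass k \<Longrightarrow> 1 \<le> k" "T \<in> tclass k \<Longrightarrow> tournament T"
  "T \<in> tclass k \<Longrightarrow> X \<subseteq> pverts T \<Longrightarrow> X \<noteq> {} \<Longrightarrow> tdet (induced T X) \<le> k\<^sup>2"
  by (auto simp: tclass_def)

text \<open>Up to switching along \<open>s\<close>, the map \<open>f\<close> embeds \<open>S\<close>
  into \<open>T\<close>, so every subtournament of \<open>S\<close> has the determinant of a
  subtournament of \<open>T\<close>. Passing to subtournaments, isomorphic copies and switches are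
  all instances.\<close>

lemma tclass_embed:
  assumes T: "T \<in> tclass k" and S: "tournament S"
    and f: "inj_on f (pverts S)" "f ` pverts S \<subseteq> pverts T"
    and s: "\<And>x. x \<in> pverts S \<Longrightarrow> s x = 1 \<or> s x = -1"
    and eq: "\<And>x y. x \<in> pverts S \<Longrightarrow> y \<in> pverts S \<Longrightarrow>
      theta S x y = s x * s y * theta T (f x) (f y)"
  shows "S \<in> tclass k"
proof -
  have "tdet (induced S X) \<le> k\<^sup>2" if X: "X \<subseteq> pverts S" "X \<noteq> {}" for X
  proof -
    have "tdet (induced S X) = tdet (induced T (f ` X))"
    proof (rule tdet_signed_bij[where f = f and s = s])
      show "bij_betw f (pverts (induced S X)) (pverts (induced T (f ` X)))"
        using f(1) X by (auto simp: bij_betw_def intro: inj_on_subset)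
      show "finite (pverts (induced S X))"
        using X tournament_finite[OF S] by (auto intro: finite_subset)
    qed (use X s eq in \<open>auto simp: theta_induced subset_iff\<close>)
    also have "\<dots> \<le> k\<^sup>2"
      using X f by (intro tclassD(3)[OF T]) auto
    finally show ?thesis .
  qed
  then show ?thesis
    using S tclassD(1)[OF T] by (auto simp: tclass_def)
qed

lemma tclass_induced:
  assumes "T \<in> tclass k" "X \<subseteq> pverts T" "X \<noteq> {}"
  shows "induced T X \<in> tclass k"
  by (rule tclass_embed[OF assms(1), where f = id and s = "\<lambda>_. 1"])
    (use assms tournament_induced[of T X] tclassD(2) in \<open>auto simp: theta_induced\<close>)

lemma tclass_switch_iff:
  assumes T: "tournament T"
  shows "switch T W \<in> tclass k \<longleftrightarrow> T \<in> tclass k"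
proof
  show "switch T W \<in> tclass k" if "T \<in> tclass k"
    by (rule tclass_embed[OF that tournament_switch[OF T], where f = id and s = "switch_sign W"])
      (auto simp: theta_switch[OF T] switch_sign_def)
  show "T \<in> tclass k" if "switch T W \<in> tclass k"
    by (rule tclass_embed[OF that T, where f = id and s = "switch_sign W"])
      (auto simp: theta_switch[OF T] switch_sign_def)
qed


section \<open>Blowups as maps\<close>

lemma induced_induced: "Y \<subseteq> X \<Longrightarrow> induced (induced T X) Y = induced T Y"
  by (auto simp: induced_def)

text \<open>If transitivity failed at two consecutive arcs, the third arc would close a 3-cycle.
  Conversely, transitivity shrinks a cycle to a loop.\<close>

lemma transitive_tournament_iff:
  "transitive_tournament T \<longleftrightarrow> tournament T \<and> trans (parcs T)"
proof -
  have "acyclic (parcs T) \<longleftrightarrow> trans (parcs T)" if T: "tournament T"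
  proof
    assume acyc: "acyclic (parcs T)"
    show "trans (parcs T)"
    proof (rule transI)
      fix x y z assume xy: "(x, y) \<in> parcs T" and yz: "(y, z) \<in> parcs T"
      have "(z, x) \<notin> parcs T"
      proof
        assume "(z, x) \<in> parcs T"
        then have "(x, x) \<in> (parcs T)\<^sup>+"
          using xy yz by (meson trancl.simps)
        then show False
          using acyc by (simp add: acyclic_def)
      qed
      moreover have "x \<noteq> z"
        using tournament_arcD(4)[OF T xy] yz by auto
      ultimately show "(x, z) \<in> parcs T"
        using tournament_arc_cases[OF T] tournament_arcD[OF T] xy yz by metis
    qed
  next
    assume "trans (parcs T)"
    then show "acyclic (parcs T)"
      using tournament_arcD(3)[OF T] by (auto simp: acyclic_def)
  qed
  then show ?thesis
    by (auto simp: transitive_tournament_def)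
qed

text \<open>A tournament \<open>T\<close> is a transitive blowup of \<open>H\<close> precisely if it has such a map; the
  parts are its fibres.\<close>
definition blowup_map ::
    "'a pair_pre_digraph \<Rightarrow> 'b pair_pre_digraph \<Rightarrow> ('b \<Rightarrow> 'a) \<Rightarrow> bool" where
  "blowup_map H T \<pi> \<longleftrightarrow> \<pi> ` pverts T = pverts H \<and>
     (\<forall>x\<in>pverts T. \<forall>y\<in>pverts T. \<pi> x \<noteq> \<pi> y \<longrightarrow> theta T x y = theta H (\<pi> x) (\<pi> y)) \<and>
     (\<forall>x\<in>pverts T. \<forall>y\<in>pverts T. \<forall>z\<in>pverts T. \<pi> x = \<pi> y \<longrightarrow> \<pi> y = \<pi> z \<longrightarrow>
        theta T x y = 1 \<longrightarrow> theta T y z = 1 \<longrightarrow> theta T x z = 1)"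

lemma blowup_mapD:
  assumes "blowup_map H T \<pi>"
  shows "\<pi> ` pverts T = pverts H"
    and "x \<in> pverts T \<Longrightarrow> \<pi> x \<in> pverts H"
    and "x \<in> pverts T \<Longrightarrow> y \<in> pverts T \<Longrightarrow> \<pi> x \<noteq> \<pi> y \<Longrightarrow> theta T x y = theta H (\<pi> x) (\<pi> y)"
    and "x \<in> pverts T \<Longrightarrow> y \<in> pverts T \<Longrightarrow> z \<in> pverts T \<Longrightarrow> \<pi> x = \<pi> y \<Longrightarrow> \<pi> y = \<pi> z \<Longrightarrow>
      theta T x y = 1 \<Longrightarrow> theta T y z = 1 \<Longrightarrow> theta T x z = 1"
  using assms unfolding blowup_map_def by blast+

text \<open>A vertex is sent to the index of its part, which is unique because the parts are
  disjoint.\<close>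

lemma transitive_blowup_imp_map:
  assumes H: "tournament H" and "transitive_blowup H B"
  shows "tournament B \<and> (\<exists>\<pi>. blowup_map H B \<pi>)"
proof -
  obtain F where F: "\<And>v. v \<in> pverts H \<Longrightarrow> tournament (F v)"
      "\<And>v. v \<in> pverts H \<Longrightarrow> trans (parcs (F v))"
    and disj: "disjoint_family_on (\<lambda>v. pverts (F v)) (pverts H)" and B: "B = blowup H F"
    using assms(2) by (auto simp: transitive_blowup_def transitive_parts_def transitive_tournament_iff)
  have VB: "pverts B = (\<Union>v\<in>pverts H. pverts (F v))"
    by (simp add: B blowup_def)
  then have "\<forall>x\<in>pverts B. \<exists>v. v \<in> pverts H \<and> x \<in> pverts (F v)"
    by auto
  then obtain \<pi> where \<pi>: "\<And>x. x \<in> pverts B \<Longrightarrow> \<pi> x \<in> pverts H"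
    "\<And>x. x \<in> pverts B \<Longrightarrow> x \<in> pverts (F (\<pi> x))"
    by metis
  have \<pi>_eq: "\<pi> x = v" if "v \<in> pverts H" "x \<in> pverts (F v)" for x v
  proof (rule ccontr)
    assume "\<pi> x \<noteq> v"
    moreover have "x \<in> pverts B"
      using that VB by auto
    ultimately show False
      using disj \<pi> that unfolding disjoint_family_on_def by blast
  qed
  have arc: "(x, y) \<in> parcs B \<longleftrightarrow> x \<in> pverts B \<and> y \<in> pverts B \<and>
      (if \<pi> x = \<pi> y then (x, y) \<in> parcs (F (\<pi> x)) else (\<pi> x, \<pi> y) \<in> parcs H)" for x y
  proof
    assume "(x, y) \<in> parcs B"
    then consider v where "v \<in> pverts H" "(x, y) \<in> parcs (F v)"
      | u v where "(u, v) \<in> parcs H" "x \<in> pverts (F u)" "y \<in> pverts (F v)"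
      unfolding B blowup_def by auto
    then show "x \<in> pverts B \<and> y \<in> pverts B \<and>
      (if \<pi> x = \<pi> y then (x, y) \<in> parcs (F (\<pi> x)) else (\<pi> x, \<pi> y) \<in> parcs H)"
    proof cases
      case (1 v)
      then have "x \<in> pverts (F v)" "y \<in> pverts (F v)"
        using tournament_arcD[OF F(1)] by blast+
      then show ?thesis
        using 1 \<pi>_eq VB by auto
    next
      case (2 u v)
      then show ?thesis
        using tournament_arcD[OF H 2(1)] \<pi>_eq[of u x] \<pi>_eq[of v y] VB by auto
    qed
  next
    assume "x \<in> pverts B \<and> y \<in> pverts B \<and>
      (if \<pi> x = \<pi> y then (x, y) \<in> parcs (F (\<pi> x)) else (\<pi> x, \<pi> y) \<in> parcs H)"
    then show "(x, y) \<in> parcs B"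
      using \<pi>[of x] \<pi>[of y] unfolding B blowup_def by (auto split: if_splits)
  qed
  have tour: "tournament B"
  proof (rule tournamentI)
    show "finite (pverts B)"
      unfolding VB using tournament_finite[OF F(1)] tournament_finite[OF H] by blast
    show "pverts B \<noteq> {}"
      unfolding VB using tournament_nonempty[OF F(1)] tournament_nonempty[OF H] by blast
    show "x \<in> pverts B \<and> y \<in> pverts B \<and> x \<noteq> y \<and> (y, x) \<notin> parcs B" if "(x, y) \<in> parcs B" for x y
      using that tournament_arcD(3,4)[OF F(1)[OF \<pi>(1)]] tournament_arcD(3,4)[OF H]
      unfolding arc by (metis (full_types))
    show "(x, y) \<in> parcs B \<or> (y, x) \<in> parcs B" if "x \<in> pverts B" "y \<in> pverts B" "x \<noteq> y" for x y
      using that tournament_arc_cases[OF F(1)[OF \<pi>(1)], of x x y] \<pi>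
        tournament_arc_cases[OF H, of "\<pi> x" "\<pi> y"] unfolding arc by (metis (full_types))
  qed
  have "blowup_map H B \<pi>"
    unfolding blowup_map_def
  proof (intro conjI ballI impI)
    show "\<pi> ` pverts B = pverts H"
    proof (intro subset_antisym subsetI)
      fix v assume v: "v \<in> pverts H"
      obtain x where "x \<in> pverts (F v)"
        using tournament_nonempty[OF F(1)[OF v]] by auto
      then show "v \<in> \<pi> ` pverts B"
        using v \<pi>_eq VB by blast
    qed (use \<pi>(1) in auto)
    show "theta B x y = theta H (\<pi> x) (\<pi> y)"
      if "x \<in> pverts B" "y \<in> pverts B" "\<pi> x \<noteq> \<pi> y" for x y
      using that by (simp add: theta_def arc)
    show "theta B x z = 1"
      if "x \<in> pverts B" "y \<in> pverts B" "z \<in> pverts B" "\<pi> x = \<pi> y" "\<pi> y = \<pi> z"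
        "theta B x y = 1" "theta B y z = 1" for x y z
      using that transD[OF F(2)[OF \<pi>(1)], of x x y z] by (simp add: theta_eq_1_iff arc)
  qed
  with tour show ?thesis by blast
qed

text \<open>The fibres, with the arcs they inherit from \<open>B\<close>, serve as parts. They live
  on the vertices of \<open>B\<close>, so \<open>B\<close> is equal and not merely isomorphic to the
  blowup.\<close>

lemma blowup_of_map:
  assumes H: "tournament H" and B: "tournament B" and \<pi>: "blowup_map H B \<pi>"
  defines "F \<equiv> \<lambda>v. induced B {x \<in> pverts B. \<pi> x = v}"
  shows "transitive_parts H F" and "B = blowup H F"
proof -
  have "trans (parcs (F v))" for v
  proof (rule transI)
    fix x y z assume "(x, y) \<in> parcs (F v)" "(y, z) \<in> parcs (F v)"
    then show "(x, z) \<in> parcs (F v)"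
      using blowup_mapD(4)[OF \<pi>, of x y z] by (simp add: F_def induced_def theta_eq_1_iff)
  qed
  moreover have "tournament (F v)" if v: "v \<in> pverts H" for v
  proof -
    obtain x where "x \<in> pverts B" "\<pi> x = v"
      using v unfolding blowup_mapD(1)[OF \<pi>, symmetric] by blast
    then show ?thesis
      unfolding F_def by (intro tournament_induced[OF B]) blast+
  qed
  moreover have "disjoint_family_on (\<lambda>v. pverts (F v)) (pverts H)"
    by (auto simp: disjoint_family_on_def F_def)
  ultimately show "transitive_parts H F"
    by (simp add: transitive_parts_def transitive_tournament_iff)
  have arc: "(x, y) \<in> parcs B \<longleftrightarrow> (x, y) \<in> parcs (blowup H F)" for x y
  proof -
    have "(x, y) \<in> parcs (blowup H F) \<longleftrightarrow> x \<in> pverts B \<and> y \<in> pverts B \<and>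
        (\<pi> x = \<pi> y \<and> (x, y) \<in> parcs B \<or> (\<pi> x, \<pi> y) \<in> parcs H)"
      using blowup_mapD(2)[OF \<pi>] by (auto simp: blowup_def F_def induced_def)
    moreover have "(x, y) \<in> parcs B \<longleftrightarrow> (\<pi> x, \<pi> y) \<in> parcs H"
      if "x \<in> pverts B" "y \<in> pverts B" "\<pi> x \<noteq> \<pi> y"
      using blowup_mapD(3)[OF \<pi> that] by (metis theta_eq_1_iff)
    ultimately show ?thesis
      using tournament_arcD[OF B, of x y] tournament_arcD(3)[OF H, of "\<pi> x" "\<pi> y"] by metis
  qed
  have "pverts B = pverts (blowup H F)"
    using blowup_mapD(2)[OF \<pi>] by (auto simp: blowup_def F_def)
  with arc show "B = blowup H F"
    by (auto intro: pair_pre_digraph.equality)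
qed

lemma transitive_blowup_iff:
  assumes H: "tournament H"
  shows "transitive_blowup H B \<longleftrightarrow> tournament B \<and> (\<exists>\<pi>. blowup_map H B \<pi>)"
  using transitive_blowup_imp_map[OF H] blowup_of_map[OF H] unfolding transitive_blowup_def by blast

text \<open>Choosing one vertex in each part yields a copy of \<open>H\<close> in
  \<open>T\<close>.\<close>

lemma blowup_map_section:
  assumes H: "tournament H" and T: "tournament T" and \<pi>: "blowup_map H T \<pi>"
  shows "\<exists>h. (\<forall>p\<in>pverts H. h p \<in> pverts T \<and> \<pi> (h p) = p) \<and> inj_on h (pverts H) \<and>
    (\<forall>p\<in>pverts H. \<forall>q\<in>pverts H. theta T (h p) (h q) = theta H p q)"
proof -
  define h where "h = inv_into (pverts T) \<pi>"
  have h: "h p \<in> pverts T" "\<pi> (h p) = p" if "p \<in> pverts H" for p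
    using that blowup_mapD(1)[OF \<pi>] by (simp_all add: h_def inv_into_into f_inv_into_f)
  have "inj_on h (pverts H)"
    using h(2) by (rule inj_on_inverseI)
  moreover have "theta T (h p) (h q) = theta H p q" if "p \<in> pverts H" "q \<in> pverts H" for p q
  proof (cases "p = q")
    case False
    then show ?thesis
      using blowup_mapD(3)[OF \<pi>, of "h p" "h q"] h that by auto
  qed (simp add: theta_self H T)
  ultimately show ?thesis
    using h by blast
qed

section \<open>Linear orders inside the parts\<close>

text \<open>A new element either comes after the old first element or precedes it, and then precedes
  all others by transitivity. The relation is abstract because the lemma is applied to an order and
  to its converse.\<close>

lemma ex_first_element:
  assumes "finite A" "A \<noteq> {}"
    and "\<And>x y. x \<in> A \<Longrightarrow> y \<in> A \<Longrightarrow> x \<noteq> y \<Longrightarrow> R x y \<or> R y x"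
    and "\<And>x y z. x \<in> A \<Longrightarrow> y \<in> A \<Longrightarrow> z \<in> A \<Longrightarrow> R x y \<Longrightarrow> R y z \<Longrightarrow> R x z"
  shows "\<exists>v\<in>A. \<forall>w\<in>A - {v}. R v w"
  using assms
proof (induction A rule: finite_ne_induct)
  case (insert x F)
  have "\<exists>v\<in>F. \<forall>w\<in>F - {v}. R v w"
    by (rule insert.IH) (erule (2) insert.prems(1)[OF insertI2 insertI2]
      | erule (4) insert.prems(2)[OF insertI2 insertI2 insertI2])+
  then obtain v where v: "v \<in> F" "\<forall>w\<in>F - {v}. R v w"
    by blast
  show ?case
  proof (cases "R v x")
    case True
    then show ?thesis
      using v by auto
  next
    case False
    then have "R x v"
      using insert.prems(1)[of v x] v insert.hyps by auto
    then have "R x w" if "w \<in> F" for w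
      using that v insert.prems(2)[of x v w] by (cases "w = v") auto
    then show ?thesis by auto
  qed
next
  case (singleton x)
  show ?case by simp
qed

text \<open>A new vertex with signs \<open>\<tau>\<close> fits into the linear order of \<open>A\<close>; the vertex \<open>v\<close> is
  one of its neighbours there.\<close>
lemma transitive_ex_neighbour:
  assumes T: "tournament T" and A: "A \<subseteq> pverts T" "A \<noteq> {}"
    and trans: "\<And>x y z. x \<in> A \<Longrightarrow> y \<in> A \<Longrightarrow> z \<in> A \<Longrightarrow>
      theta T x y = 1 \<Longrightarrow> theta T y z = 1 \<Longrightarrow> theta T x z = 1"
    and \<tau>: "\<And>x. x \<in> A \<Longrightarrow> \<tau> x = 1 \<or> \<tau> x = (-1 :: int)"
    and mono: "\<And>x y. x \<in> A \<Longrightarrow> y \<in> A \<Longrightarrow> theta T x y = 1 \<Longrightarrow> \<tau> x = 1 \<Longrightarrow> \<tau> y = 1"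
  shows "\<exists>v\<in>A. \<forall>w\<in>A - {v}. \<tau> w = theta T v w"
proof -
  have fin: "finite A"
    using A(1) tournament_finite[OF T] by (rule finite_subset)
  have total: "theta T x y = 1 \<or> theta T y x = 1" if "x \<in> A" "y \<in> A" "x \<noteq> y" for x y
    using theta_cases[OF T, of x y] theta_antisym[OF T, of y x] that A by auto
  \<comment> \<open>\<open>?N\<close> collects the vertices that precede the new one. The neighbour
    is the last vertex of \<open>?N\<close>, or the first vertex of \<open>A\<close> if
    \<open>?N\<close> is empty.\<close>
  let ?N = "{x \<in> A. \<tau> x = -1}"
  show ?thesis
  proof (cases "?N = {}")
    case True
    then have "\<tau> w = 1" if "w \<in> A" for w
      using \<tau> that by auto
    moreover have "\<exists>v\<in>A. \<forall>w\<in>A - {v}. theta T v w = 1"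
      by (rule ex_first_element) (use fin A total trans in blast)+
    ultimately show ?thesis
      by (metis DiffD1)
  next
    case False
    have "\<exists>v\<in>?N. \<forall>w\<in>?N - {v}. theta T w v = 1"
    proof (rule ex_first_element)
      show "finite ?N"
        using fin by simp
      show "theta T y x = 1 \<or> theta T x y = 1" if "x \<in> ?N" "y \<in> ?N" "x \<noteq> y" for x y
        using total that by blast
      show "theta T z x = 1" if "x \<in> ?N" "y \<in> ?N" "z \<in> ?N" "theta T y x = 1" "theta T z y = 1" for x y z
        using trans that by blast
    qed (rule False)
    then obtain v where v: "v \<in> A" "\<tau> v = -1" "\<And>w. w \<in> ?N \<Longrightarrow> w \<noteq> v \<Longrightarrow> theta T w v = 1"
      by auto
    have "\<tau> w = theta T v w" if w: "w \<in> A" "w \<noteq> v" for w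
    proof (cases "\<tau> w = 1")
      case True
      then have "theta T w v \<noteq> 1"
        using mono[of w v] v w by auto
      then show ?thesis
        using True total[of v w] v w by auto
    next
      case False
      then show ?thesis
        using \<tau>[of w] v(3)[of w] w theta_antisym[OF T, of v w] by auto
    qed
    then show ?thesis
      using v(1) by auto
  qed
qed

text \<open>\<open>z\<close> is a neighbour of \<open>x\<close> in the linear order on the vertices
  of \<open>X\<close> in the part of \<open>x\<close>. Vertices in other parts see \<open>x\<close>
  and \<open>z\<close> through the same vertex of \<open>H\<close>.\<close>

lemma blowup_map_ex_covertex:
  assumes T: "tournament T" and \<pi>: "blowup_map H T \<pi>" and X: "X \<subseteq> pverts T"
    and xy: "x \<in> X" "y \<in> X" "x \<noteq> y" "\<pi> x = \<pi> y"
  obtains z where "z \<in> X" "z \<noteq> x" "\<pi> z = \<pi> x"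
    "\<And>w. w \<in> X \<Longrightarrow> w \<noteq> x \<Longrightarrow> w \<noteq> z \<Longrightarrow> theta T x w = theta T z w"
proof -
  let ?A = "{z \<in> X. z \<noteq> x \<and> \<pi> z = \<pi> x}"
  have "\<exists>v\<in>?A. \<forall>w\<in>?A - {v}. theta T x w = theta T v w"
  proof (rule transitive_ex_neighbour[OF T])
    show "?A \<subseteq> pverts T" "?A \<noteq> {}"
      using X xy by auto
    show "theta T x w = 1 \<or> theta T x w = -1" if "w \<in> ?A" for w
      using that X xy by (intro theta_cases[OF T]) auto
    show "theta T u w = 1"
      if "u \<in> ?A" "v \<in> ?A" "w \<in> ?A" "theta T u v = 1" "theta T v w = 1" for u v w
      using that X by (intro blowup_mapD(4)[OF \<pi>, of u v w]) auto
    show "theta T x w = 1" if "v \<in> ?A" "w \<in> ?A" "theta T v w = 1" "theta T x v = 1" for v w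
      using that X xy by (intro blowup_mapD(4)[OF \<pi>, of x v w]) auto
  qed
  then obtain z where z: "z \<in> ?A" "\<And>w. w \<in> ?A \<Longrightarrow> w \<noteq> z \<Longrightarrow> theta T x w = theta T z w"
    by blast
  have "theta T x w = theta T z w" if "w \<in> X" "w \<noteq> x" "w \<noteq> z" for w
  proof (cases "\<pi> w = \<pi> x")
    case True
    then show ?thesis using z that by auto
  next
    case False
    then have "theta T x w = theta H (\<pi> x) (\<pi> w)" "theta T z w = theta H (\<pi> z) (\<pi> w)"
      using that xy(1) X z(1) by (simp_all add: blowup_mapD(3)[OF \<pi>] subset_iff)
    then show ?thesis
      using z(1) by simp
  qed
  then show ?thesis
    using that z(1) by blast
qed

text \<open>\<open>T\<close> contains a copy of \<open>H\<close>, which gives one direction. For the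
  other, a set that meets each part at most once is a copy of a subtournament of \<open>H\<close>;
  any other set contains two covertices, whose deletion keeps the determinant.\<close>

lemma tclass_blowup_iff:
  assumes H: "tournament H" and T: "tournament T" and \<pi>: "blowup_map H T \<pi>"
  shows "T \<in> tclass k \<longleftrightarrow> H \<in> tclass k"
proof
  assume "T \<in> tclass k"
  moreover obtain h where "\<forall>p\<in>pverts H. h p \<in> pverts T" "inj_on h (pverts H)"
    "\<forall>p\<in>pverts H. \<forall>q\<in>pverts H. theta T (h p) (h q) = theta H p q"
    using blowup_map_section[OF assms] by blast
  ultimately show "H \<in> tclass k"
    using H by (intro tclass_embed[where T = T and f = h and s = "\<lambda>_. 1"]) auto
next
  assume Hk: "H \<in> tclass k"
  \<comment> \<open>The empty set is included because deleting a pair may exhaust \<open>X\<close>;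
    its determinant 1 also respects the bound.\<close>
  have "tdet (induced T X) \<le> k\<^sup>2" if "X \<subseteq> pverts T" for X
    using that
  proof (induction "card X" arbitrary: X rule: less_induct)
    case less
    have fin: "finite X"
      using less.prems tournament_finite[OF T] by (rule finite_subset)
    consider "X = {}" | "X \<noteq> {}" "inj_on \<pi> X" | x y where "x \<in> X" "y \<in> X" "x \<noteq> y" "\<pi> x = \<pi> y"
      unfolding inj_on_def by blast
    then show ?case
    proof cases
      case 1
      then show ?thesis
        using tclassD(1)[OF Hk] by (simp add: tdet_empty)
    next
      case 2
      have "tdet (induced T X) = tdet (induced H (\<pi> ` X))"
      proof (rule tdet_signed_bij[where f = \<pi> and s = "\<lambda>_. 1"])
        fix x y assume xy: "x \<in> pverts (induced T X)" "y \<in> pverts (induced T X)"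
        have "theta T x y = theta H (\<pi> x) (\<pi> y)"
        proof (cases "x = y")
          case False
          then have "\<pi> x \<noteq> \<pi> y"
            using 2 xy by (auto dest: inj_onD)
          then show ?thesis
            using xy less.prems by (intro blowup_mapD(3)[OF \<pi>]) auto
        qed (simp add: theta_self H T)
        then show "theta (induced T X) x y = 1 * 1 * theta (induced H (\<pi> ` X)) (\<pi> x) (\<pi> y)"
          using xy by (simp add: theta_induced)
      qed (use 2 fin in \<open>auto simp: bij_betw_def\<close>)
      also have "\<dots> \<le> k\<^sup>2"
        using 2 less.prems blowup_mapD(2)[OF \<pi>] by (intro tclassD(3)[OF Hk]) auto
      finally show ?thesis .
    next
      case (3 x y)
      then obtain z where z: "z \<in> X" "z \<noteq> x"
        "\<And>w. w \<in> X \<Longrightarrow> w \<noteq> x \<Longrightarrow> w \<noteq> z \<Longrightarrow> theta T x w = theta T z w"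
        using blowup_map_ex_covertex[OF T \<pi> less.prems] by metis
      have "CR_associated (induced T X) x z"
        using z 3 by (auto simp: CR_associated_def covertices_def theta_induced)
      then have "tdet (induced T X) = tdet (induced (induced T X) (X - {x, z}))"
        using tdet_CR_associated[OF tournament_induced[OF T less.prems]] 3 by auto
      also have "\<dots> = tdet (induced T (X - {x, z}))"
        by (simp add: induced_induced Diff_subset)
      also have "\<dots> \<le> k\<^sup>2"
        using less.prems 3 fin by (intro less.hyps psubset_card_mono) auto
      finally show ?thesis .
    qed
  qed
  then show "T \<in> tclass k"
    using T tclassD(1)[OF Hk] by (simp add: tclass_def)
qed


section \<open>CR tournaments\<close>

text \<open>If the three signs on the cycle agree, the apex \<open>v\<close> matches them. Otherwise
  the signs change twice around the cycle, once in each direction; the change that starts from the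
  sign \<open>- \<delta> * \<sigma> v\<close> is matched by the third vertex of the cycle.\<close>

lemma diamond_signs:
  assumes T: "diamond T" and \<sigma>: "\<sigma> \<in> pverts T \<rightarrow> {1, -1}"
  shows "\<exists>v\<in>pverts T. \<exists>\<epsilon>\<in>{1, -1}. \<forall>w\<in>pverts T - {v}. \<sigma> w = \<epsilon> * theta T v w" (is ?thesis)
proof -
  have tour: "tournament T"
    using T by (simp add: diamond_def)
  obtain v where v: "v \<in> pverts T" "three_cycle (induced T (pverts T - {v}))"
    and dom: "(\<forall>w\<in>pverts T - {v}. (v, w) \<in> parcs T) \<or> (\<forall>w\<in>pverts T - {v}. (w, v) \<in> parcs T)"
    using T by (auto simp: diamond_def)
  obtain a b c where abc: "distinct [a, b, c]" "pverts T - {v} = {a, b, c}"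
    "parcs (induced T {a, b, c}) = {(a, b), (b, c), (c, a)}"
    using v(2) by (auto simp: three_cycle_def)
  obtain \<delta> where \<delta>: "\<delta> = 1 \<or> \<delta> = -1" "\<And>w. w \<in> {a, b, c} \<Longrightarrow> theta T v w = \<delta>"
  proof -
    from dom consider "\<forall>w\<in>{a, b, c}. (v, w) \<in> parcs T" | "\<forall>w\<in>{a, b, c}. (w, v) \<in> parcs T"
      unfolding abc(2) by blast
    then show thesis
    proof cases
      case 1
      then show thesis by (intro that[of 1]) (auto simp: theta_eq_1_iff)
    next
      case 2
      then show thesis
        using theta_antisym[OF tour, of v] by (intro that[of "-1"]) (auto simp: theta_eq_1_iff[symmetric])
    qed
  qed
  have th: "theta T a b = 1" "theta T b c = 1" "theta T c a = 1"
    using abc(3) by (auto simp: theta_eq_1_iff induced_def set_eq_iff)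
  note th' = th[THEN arg_cong[where f = uminus], folded theta_antisym[OF tour]]
  have V: "pverts T = {v, a, b, c}" and vn: "v \<notin> {a, b, c}"
    using abc(2) v(1) by blast+
  have \<delta>': "theta T w v = - \<delta>" if "w \<in> {a, b, c}" for w
    using \<delta>(2)[OF that] theta_antisym[OF tour, of w v] by simp
  have s: "\<sigma> w = 1 \<or> \<sigma> w = -1" if "w \<in> pverts T" for w
    using \<sigma> that by auto
  have I: ?thesis if "x \<in> pverts T" "\<epsilon> = 1 \<or> \<epsilon> = -1"
    "\<And>w. w \<in> pverts T \<Longrightarrow> w \<noteq> x \<Longrightarrow> \<sigma> w = \<epsilon> * theta T x w" for x \<epsilon>
    using that by blast
  have 1: ?thesis if "\<sigma> a = \<sigma> b" "\<sigma> b = \<sigma> c"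
    by (rule I[of v "\<sigma> a * \<delta>"]) (use V that \<delta> s[of a] s[of b] s[of c] in auto)
  have 2: ?thesis if "\<sigma> c = - \<sigma> b" "\<sigma> v = - \<delta> * \<sigma> b"
    by (rule I[of a "\<sigma> b"]) (use V that \<delta>' th th' s[of b] in auto)
  have 3: ?thesis if "\<sigma> a = - \<sigma> c" "\<sigma> v = - \<delta> * \<sigma> c"
    by (rule I[of b "\<sigma> c"]) (use V that \<delta>' th th' s[of c] in auto)
  have 4: ?thesis if "\<sigma> b = - \<sigma> a" "\<sigma> v = - \<delta> * \<sigma> a"
    by (rule I[of c "\<sigma> a"]) (use V that \<delta>' th th' s[of a] in auto)
  have "\<sigma> a = 1 \<or> \<sigma> a = -1" "\<sigma> b = 1 \<or> \<sigma> b = -1" "\<sigma> c = 1 \<or> \<sigma> c = -1" "\<sigma> v = 1 \<or> \<sigma> v = -1"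
    using s V by auto
  then show ?thesis
    using 1 2 3 4 \<delta>(1) by (elim disjE) simp_all
qed

text \<open>The condition on CR tournaments in contrapositive form, for a fixed \<open>k\<close> and
  without the exceptional small cases. CR vertices are expressed through signs as in
  \<open>CR_vertex_iff\<close>.\<close>

definition CR_extensions :: "int \<Rightarrow> 'a pair_pre_digraph \<Rightarrow> bool" where
  "CR_extensions k T \<longleftrightarrow> (\<forall>u \<sigma>. u \<notin> pverts T \<longrightarrow> \<sigma> \<in> pverts T \<rightarrow> {1, -1} \<longrightarrow>
     extend T u \<sigma> \<in> tclass k \<longrightarrow>
     (\<exists>v\<in>pverts T. \<exists>\<epsilon>\<in>{1, -1}. \<forall>w\<in>pverts T - {v}. \<sigma> w = \<epsilon> * theta T v w))"

lemma CR_extensionsD: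
  assumes "CR_extensions k T" "u \<notin> pverts T" "\<sigma> \<in> pverts T \<rightarrow> {1, -1}" "extend T u \<sigma> \<in> tclass k"
  obtains v \<epsilon> where "v \<in> pverts T" "\<epsilon> \<in> {1, -1}"
    "\<And>w. w \<in> pverts T \<Longrightarrow> w \<noteq> v \<Longrightarrow> \<sigma> w = \<epsilon> * theta T v w"
  using assms unfolding CR_extensions_def by (metis Diff_iff singletonD)

text \<open>The exception made for the diamond is vacuous: every vertex is a CR vertex for it.\<close>
lemma CR_tournament_iff:
  assumes k: "odd k" and T: "T \<in> tclass k - tclass (k - 2)" and card: "3 \<le> card (pverts T)"
  shows "CR_tournament T \<longleftrightarrow> CR_extensions k T"
proof -
  have tour: "tournament T"
    using T tclassD(2) by auto
  have ext: "CR_extensions k T \<longleftrightarrow> (\<forall>u \<sigma>. u \<notin> pverts T \<longrightarrow> \<sigma> \<in> pverts T \<rightarrow> {1, -1} \<longrightarrow>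
      \<not> CR_vertex T u \<sigma> \<longrightarrow> extend T u \<sigma> \<notin> tclass k)"
    unfolding CR_extensions_def using CR_vertex_iff[OF tour] by metis
  have dia: "CR_extensions k T" if "diamond T"
    unfolding CR_extensions_def using diamond_signs[OF that] by blast
  show ?thesis
  proof
    assume "CR_tournament T"
    then obtain l where l: "odd l" "T \<in> tclass l - tclass (l - 2)"
      "diamond T \<or> (\<forall>u \<sigma>. u \<notin> pverts T \<longrightarrow> \<sigma> \<in> pverts T \<rightarrow> {1, -1} \<longrightarrow>
         \<not> CR_vertex T u \<sigma> \<longrightarrow> extend T u \<sigma> \<notin> tclass l)"
      using card unfolding CR_tournament_def by fastforce
    then have "l = k"
      using tclass_unique k T by blast
    then show "CR_extensions k T"
      using l(3) dia ext by metis
  next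
    assume "CR_extensions k T"
    then show "CR_tournament T"
      unfolding CR_tournament_def using k T ext by blast
  qed
qed


section \<open>Isomorphism and switching through blowup maps\<close>

lemma blowup_map_iso:
  assumes "blowup_map H B \<pi>" "bij_betw f (pverts S) (pverts B)"
    and "\<And>u v. u \<in> pverts S \<Longrightarrow> v \<in> pverts S \<Longrightarrow> theta S u v = theta B (f u) (f v)"
  shows "blowup_map H S (\<pi> \<circ> f)"
proof -
  have f: "f x \<in> pverts B" if "x \<in> pverts S" for x
    using that assms(2) by (rule bij_betwE[rule_format, rotated])
  have im: "f ` pverts S = pverts B"
    using assms(2) by (rule bij_betw_imp_surj_on)
  show ?thesis
    unfolding blowup_map_def
  proof (intro conjI ballI impI)
    show "(\<pi> \<circ> f) ` pverts S = pverts H"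
      unfolding image_comp[symmetric] im by (rule blowup_mapD(1)[OF assms(1)])
    show "theta S x y = theta H ((\<pi> \<circ> f) x) ((\<pi> \<circ> f) y)"
      if "x \<in> pverts S" "y \<in> pverts S" "(\<pi> \<circ> f) x \<noteq> (\<pi> \<circ> f) y" for x y
      using that blowup_mapD(3)[OF assms(1), of "f x" "f y"] f assms(3) by simp
    show "theta S x z = 1"
      if "x \<in> pverts S" "y \<in> pverts S" "z \<in> pverts S" "(\<pi> \<circ> f) x = (\<pi> \<circ> f) y"
        "(\<pi> \<circ> f) y = (\<pi> \<circ> f) z" "theta S x y = 1" "theta S y z = 1" for x y z
      using that blowup_mapD(4)[OF assms(1), of "f x" "f y" "f z"] f assms(3) by simp
  qed
qed

lemma blowup_map_id: "tournament H \<Longrightarrow> blowup_map H H id"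
  by (auto simp: blowup_map_def theta_self)

lemma isomorphic_theta_iff:
  assumes "tournament S" "tournament T"
  shows "isomorphic S T \<longleftrightarrow> (\<exists>f. bij_betw f (pverts S) (pverts T) \<and>
    (\<forall>u\<in>pverts S. \<forall>v\<in>pverts S. theta S u v = theta T (f u) (f v)))"
  unfolding isomorphic_iff[OF assms] theta_eq_1_iff[symmetric]
proof (intro ex_cong1 conj_cong refl ballI iffI)
  fix f u v
  assume *: "\<forall>u\<in>pverts S. \<forall>v\<in>pverts S. theta S u v = 1 \<longleftrightarrow> theta T (f u) (f v) = 1"
    and uv: "u \<in> pverts S" "v \<in> pverts S"
  then have "(u, v) \<in> parcs S \<longleftrightarrow> (f u, f v) \<in> parcs T" "(v, u) \<in> parcs S \<longleftrightarrow> (f v, f u) \<in> parcs T"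
    by (simp_all add: theta_eq_1_iff)
  then show "theta S u v = theta T (f u) (f v)"
    by (simp add: theta_def)
qed auto

lemma switch_induced: "switch (induced T X) (W \<inter> X) = induced (switch T W) X"
  by (auto simp: switch_def induced_def)

lemma switch_Int_pverts: "tournament T \<Longrightarrow> switch T (W \<inter> pverts T) = switch T W"
  using switch_induced[of T "pverts T" W] induced_all[of T] induced_all[OF tournament_switch]
  by simp

lemma switch_empty: "switch T {} = T"
  by (cases T) (simp add: switch_def)

text \<open>Composing with the isomorphism carries the blowup map from \<open>B\<close> to the
  switch of \<open>T\<close>. Backwards, the switch itself serves as \<open>B\<close>, and only the
  trace of \<open>W\<close> on the vertices matters.\<close>

lemma switching_equiv_transitive_blowup_iff:
  fixes T :: "'a::infinite pair_pre_digraph"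
  assumes T: "tournament T" and H: "tournament H"
  shows "switching_equiv_transitive_blowup T H \<longleftrightarrow> (\<exists>W \<pi>. blowup_map H (switch T W) \<pi>)"
proof
  assume "switching_equiv_transitive_blowup T H"
  then obtain W and B :: "'a pair_pre_digraph" where WB: "transitive_blowup H B" "isomorphic (switch T W) B"
    unfolding switching_equiv_transitive_blowup_def by blast
  obtain \<pi> where B: "tournament B" "blowup_map H B \<pi>"
    using transitive_blowup_imp_map[OF H WB(1)] by blast
  obtain f where "bij_betw f (pverts (switch T W)) (pverts B)"
    "\<forall>u\<in>pverts (switch T W). \<forall>v\<in>pverts (switch T W). theta (switch T W) u v = theta B (f u) (f v)"
    using WB(2) unfolding isomorphic_theta_iff[OF tournament_switch[OF T] B(1)] by blast
  then show "\<exists>W \<pi>. blowup_map H (switch T W) \<pi>"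
    using blowup_map_iso[OF B(2)] by blast
next
  assume "\<exists>W \<pi>. blowup_map H (switch T W) \<pi>"
  then obtain W \<pi> where \<pi>: "blowup_map H (switch T (W \<inter> pverts T)) \<pi>"
    using switch_Int_pverts[OF T] by metis
  have S: "tournament (switch T (W \<inter> pverts T))"
    by (rule tournament_switch[OF T])
  have "transitive_blowup H (switch T (W \<inter> pverts T))"
    using transitive_blowup_iff[OF H] S \<pi> by blast
  moreover have "isomorphic (switch T (W \<inter> pverts T)) (switch T (W \<inter> pverts T))"
    unfolding isomorphic_theta_iff[OF S S] by (intro exI[of _ id]) simp
  ultimately show "switching_equiv_transitive_blowup T H"
    unfolding switching_equiv_transitive_blowup_def by blast
qed

text \<open>\<open>H\<close> is a blowup of itself, and conversely a transversal of the parts is a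
  copy of \<open>H\<close>. Allowing blowups here gives the form in which a copy of \<open>H\<close>
  can be enlarged step by step.\<close>

lemma xi_iff:
  assumes H: "tournament H" and T: "tournament T"
  shows "T \<in> xi H \<longleftrightarrow>
    (\<exists>X W \<pi>. X \<subseteq> pverts T \<and> X \<noteq> {} \<and> blowup_map H (induced (switch T W) X) \<pi>)"
proof
  assume "T \<in> xi H"
  then obtain X W where X: "X \<subseteq> pverts T" "X \<noteq> {}" and W: "W \<subseteq> X"
    and iso: "isomorphic (switch (induced T X) W) H"
    by (auto simp: xi_def switching_isomorphic_def)
  have "switch (induced T X) W = induced (switch T W) X"
    using switch_induced[of T X W] W by (simp add: Int_absorb2)
  moreover have S: "tournament (switch (induced T X) W)"
    by (intro tournament_switch tournament_induced T X)
  obtain f where "bij_betw f (pverts (switch (induced T X) W)) (pverts H)"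
    "\<forall>u\<in>pverts (switch (induced T X) W). \<forall>v\<in>pverts (switch (induced T X) W).
      theta (switch (induced T X) W) u v = theta H (f u) (f v)"
    using iso unfolding isomorphic_theta_iff[OF S H] by blast
  then have "blowup_map H (switch (induced T X) W) (id \<circ> f)"
    by (intro blowup_map_iso[OF blowup_map_id[OF H]]) auto
  ultimately show "\<exists>X W \<pi>. X \<subseteq> pverts T \<and> X \<noteq> {} \<and> blowup_map H (induced (switch T W) X) \<pi>"
    using X by metis
next
  assume "\<exists>X W \<pi>. X \<subseteq> pverts T \<and> X \<noteq> {} \<and> blowup_map H (induced (switch T W) X) \<pi>"
  then obtain X W \<pi> where X: "X \<subseteq> pverts T" "X \<noteq> {}"
    and \<pi>: "blowup_map H (induced (switch T W) X) \<pi>"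
    by blast
  have S: "tournament (induced (switch T W) X)"
    using X by (intro tournament_induced tournament_switch T) auto
  obtain h where h: "\<forall>p\<in>pverts H. h p \<in> X \<and> \<pi> (h p) = p"
    "\<forall>p\<in>pverts H. \<forall>q\<in>pverts H. theta (induced (switch T W) X) (h p) (h q) = theta H p q"
    using blowup_map_section[OF H S \<pi>] by auto
  define Y where "Y = h ` pverts H"
  have Y: "Y \<subseteq> X" "Y \<noteq> {}"
    using h(1) tournament_nonempty[OF H] by (auto simp: Y_def)
  have YT: "tournament (switch (induced T Y) (W \<inter> Y))"
    using X Y by (intro tournament_switch tournament_induced T) auto
  have "isomorphic (switch (induced T Y) (W \<inter> Y)) H"
    unfolding isomorphic_theta_iff[OF YT H]
  proof (intro exI[of _ \<pi>] conjI ballI)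
    show "bij_betw \<pi> (pverts (switch (induced T Y) (W \<inter> Y))) (pverts H)"
      using h(1) by (intro bij_betw_byWitness[where f' = h]) (auto simp: Y_def)
    fix u v
    assume "u \<in> pverts (switch (induced T Y) (W \<inter> Y))" "v \<in> pverts (switch (induced T Y) (W \<inter> Y))"
    then have uv: "u \<in> Y" "v \<in> Y"
      by simp_all
    then have "u \<in> X" "v \<in> X"
      using Y(1) by auto
    have "theta (induced (switch T W) X) u v = theta H (\<pi> u) (\<pi> v)"
      using uv h by (auto simp: Y_def)
    then show "theta (switch (induced T Y) (W \<inter> Y)) u v = theta H (\<pi> u) (\<pi> v)"
      unfolding switch_induced using uv \<open>u \<in> X\<close> \<open>v \<in> X\<close> by (simp add: theta_induced)
  qed
  then have "switching_isomorphic (induced T Y) H"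
    unfolding switching_isomorphic_def by (intro exI[of _ "W \<inter> Y"]) simp
  then show "T \<in> xi H"
    unfolding xi_def using T X Y by blast
qed

text \<open>Presents a vertex \<open>u\<close> that already lies in \<open>S\<close> as a formal
  extension, so that \<open>CR_extensions\<close> applies to it.\<close>

lemma extend_induced:
  assumes S: "tournament S" and Y: "Y \<subseteq> pverts S" "Y \<noteq> {}" and u: "u \<in> pverts S" "u \<notin> Y"
    and \<sigma>: "\<And>w. w \<in> Y \<Longrightarrow> \<sigma> w = theta S u w"
  shows "extend (induced S Y) u \<sigma> = induced S (insert u Y)"
proof -
  have C: "tournament (induced S Y)"
    using S Y by (rule tournament_induced)
  have u': "u \<notin> pverts (induced S Y)"
    using u by simp
  have "\<sigma> \<in> pverts (induced S Y) \<rightarrow> {1, -1}"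
    using \<sigma> Y u theta_cases[OF S, of u] by fastforce
  note ext = theta_extend(1)[OF C u'] theta_extend(2,3)[OF C u' this]
  show ?thesis
  proof (rule tournament_eqI)
    show "tournament (extend (induced S Y) u \<sigma>)"
      using C u' by (rule tournament_extend)
    show "tournament (induced S (insert u Y))"
      using S Y u by (intro tournament_induced) auto
    fix v w assume "v \<in> pverts (extend (induced S Y) u \<sigma>)" "w \<in> pverts (extend (induced S Y) u \<sigma>)"
    then show "theta (extend (induced S Y) u \<sigma>) v w = theta (induced S (insert u Y)) v w"
      using ext \<sigma> theta_self[OF tournament_extend[OF C u']] theta_self[OF S]
        theta_antisym[OF S, of u] by (auto simp: theta_induced)
  qed simp
qed

text \<open>If \<open>p\<close> and \<open>q\<close> were distinct, the equation would make them
  CR-associated with sign \<open>\<epsilon> * \<epsilon>'\<close>. Once they coincide, any further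
  vertex compares the two signs.\<close>

lemma basic_unique:
  assumes H: "basic H" and pq: "p \<in> pverts H" "q \<in> pverts H"
    and e: "\<epsilon> \<in> {1, -1}" "\<epsilon>' \<in> {1, -1}"
    and eq: "\<And>r. r \<in> pverts H \<Longrightarrow> r \<noteq> p \<Longrightarrow> r \<noteq> q \<Longrightarrow> \<epsilon> * theta H p r = \<epsilon>' * theta H q r"
  shows "p = q \<and> \<epsilon> = \<epsilon>'"
proof -
  have T: "tournament H" and card: "4 \<le> card (pverts H)"
    using H by (auto simp: basic_def)
  have "p = q"
  proof (rule ccontr)
    assume "p \<noteq> q"
    have "theta H p r = (\<epsilon> * \<epsilon>') * theta H q r" if "r \<in> pverts H - {p, q}" for r
      using eq[of r] that e by auto
    then have "CR_associated H p q"
      unfolding CR_associated_iff using pq \<open>p \<noteq> q\<close> e by (intro conjI bexI[of _ "\<epsilon> * \<epsilon>'"]) auto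
    then show False
      using H pq \<open>p \<noteq> q\<close> by (auto simp: basic_def)
  qed
  moreover obtain r where r: "r \<in> pverts H" "r \<noteq> p"
  proof -
    have "pverts H \<noteq> {p}"
      using card by auto
    then show ?thesis
      using that pq by blast
  qed
  ultimately show ?thesis
    using eq[of r] theta_cases[OF T pq(1) r(1)] by auto
qed

lemma card_blowup:
  assumes "tournament B" "blowup_map H B \<pi>"
  shows "card (pverts H) \<le> card (pverts B)"
  using card_image_le[OF tournament_finite[OF assms(1)], of \<pi>] blowup_mapD(1)[OF assms(2)] by simp


section \<open>Extensions of blowups\<close>

text \<open>The part of \<open>y\<close> consists of \<open>y\<close> and
  \<open>h (\<pi> y)\<close>; every other part is a single vertex of the transversal.\<close>

lemma one_transitive_blowup_of_section:
  assumes H: "tournament H" and B: "tournament B" and \<pi>: "blowup_map H B \<pi>"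
    and h: "\<And>p. p \<in> pverts H \<Longrightarrow> h p \<in> pverts B" "\<And>p. p \<in> pverts H \<Longrightarrow> \<pi> (h p) = p"
    and y: "y \<in> pverts B" "y \<notin> h ` pverts H"
  defines "X \<equiv> insert y (h ` pverts H)"
  shows "blowup_map H (induced B X) \<pi>" and "one_transitive_blowup H (induced B X)"
proof -
  have X: "X \<subseteq> pverts B" "X \<noteq> {}"
    using h y by (auto simp: X_def)
  have C: "tournament (induced B X)"
    using B X by (rule tournament_induced)
  show \<pi>C: "blowup_map H (induced B X) \<pi>"
    unfolding blowup_map_def
  proof (intro conjI ballI impI)
    show "\<pi> ` pverts (induced B X) = pverts H"
      using h(2) blowup_mapD(2)[OF \<pi> y(1)] by (force simp: X_def)
    show "theta (induced B X) v w = theta H (\<pi> v) (\<pi> w)"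
      if "v \<in> pverts (induced B X)" "w \<in> pverts (induced B X)" "\<pi> v \<noteq> \<pi> w" for v w
      using that X blowup_mapD(3)[OF \<pi>, of v w] by (auto simp: theta_induced)
    show "theta (induced B X) u w = 1"
      if "u \<in> pverts (induced B X)" "v \<in> pverts (induced B X)" "w \<in> pverts (induced B X)"
        "\<pi> u = \<pi> v" "\<pi> v = \<pi> w" "theta (induced B X) u v = 1" "theta (induced B X) v w = 1" for u v w
      using that X blowup_mapD(4)[OF \<pi>, of u v w] by (auto simp: theta_induced)
  qed
  define F where "F v = induced (induced B X) {x \<in> X. \<pi> x = v}" for v
  have F: "transitive_parts H F" "induced B X = blowup H F"
    using blowup_of_map[OF H C \<pi>C] by (simp_all add: F_def[abs_def])
  have py: "\<pi> y \<in> pverts H"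
    using blowup_mapD(2)[OF \<pi> y(1)] .
  have "{x \<in> X. \<pi> x = \<pi> y} = {y, h (\<pi> y)}"
    using h py by (auto simp: X_def)
  moreover have "y \<noteq> h (\<pi> y)"
    using y py by auto
  ultimately have "card (pverts (F (\<pi> y))) = 2"
    by (simp add: F_def)
  moreover have "card (pverts (F w)) = 1" if "w \<in> pverts H - {\<pi> y}" for w
  proof -
    have "{x \<in> X. \<pi> x = w} = {h w}"
      using h that by (auto simp: X_def)
    then show ?thesis
      by (simp add: F_def)
  qed
  ultimately show "one_transitive_blowup H (induced B X)"
    unfolding one_transitive_blowup_def using F py by blast
qed

lemma strong_CR_blowup:
  fixes H B :: "'a::infinite pair_pre_digraph"
  assumes k: "odd k" and Hk: "H \<in> tclass k - tclass (k - 2)" and basic: "basic H"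
    and strong: "strong_CR_tournament H" and B: "tournament B" and \<pi>: "blowup_map H B \<pi>"
  shows "CR_extensions k B"
  unfolding CR_extensions_def
proof (intro allI impI)
  fix u :: 'a and \<sigma> :: "'a \<Rightarrow> int"
  assume u: "u \<notin> pverts B" and \<sigma>: "\<sigma> \<in> pverts B \<rightarrow> {1, -1}" and E: "extend B u \<sigma> \<in> tclass k"
  have H: "tournament H" and card: "4 \<le> card (pverts H)"
    using basic by (auto simp: basic_def)
  let ?E = "extend B u \<sigma>"
  have ET: "tournament ?E"
    using B u by (rule tournament_extend)
  note ext = theta_extend(1)[OF B u] theta_extend(2,3)[OF B u \<sigma>]
  obtain h where h: "\<And>p. p \<in> pverts H \<Longrightarrow> h p \<in> pverts B" "\<And>p. p \<in> pverts H \<Longrightarrow> \<pi> (h p) = p"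
    and h_inj: "inj_on h (pverts H)"
    and h_theta: "\<And>p q. p \<in> pverts H \<Longrightarrow> q \<in> pverts H \<Longrightarrow> theta B (h p) (h q) = theta H p q"
    using blowup_map_section[OF H B \<pi>] by metis

  have "CR_extensions k H"
    using CR_tournament_iff[OF k Hk] strong card by (simp add: strong_CR_tournament_def)
  \<comment> \<open>\<open>u\<close> lies outside \<open>B\<close> but may be a vertex of
    \<open>H\<close>, so a fresh vertex \<open>u'\<close> stands for it over
    \<open>H\<close>.\<close>
  moreover obtain u' where u': "u' \<notin> pverts H"
    using ex_new_if_finite[OF infinite_UNIV tournament_finite[OF H]] by blast
  moreover have s': "\<sigma> \<circ> h \<in> pverts H \<rightarrow> {1, -1}"
    using \<sigma> h(1) by auto
  moreover have "extend H u' (\<sigma> \<circ> h) \<in> tclass k"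
  proof (rule tclass_embed[OF E tournament_extend[OF H u']])
    let ?f = "\<lambda>x. if x = u' then u else h x"
    have fu: "?f u' = u" "\<And>p. p \<in> pverts H \<Longrightarrow> ?f p = h p"
      using u' by auto
    have "u \<notin> h ` pverts H"
      using h(1) u by blast
    moreover have "inj_on ?f (pverts H)" "?f ` pverts H = h ` pverts H"
      using h_inj fu(2) by (simp_all cong: inj_on_cong image_cong)
    ultimately show "inj_on ?f (pverts (extend H u' (\<sigma> \<circ> h)))"
      using u' by (simp add: inj_on_insert)
    show "?f ` pverts (extend H u' (\<sigma> \<circ> h)) \<subseteq> pverts ?E"
      using h(1) by auto
    fix x y assume "x \<in> pverts (extend H u' (\<sigma> \<circ> h))" "y \<in> pverts (extend H u' (\<sigma> \<circ> h))"
    then consider "x = u'" "y = u'" | "x = u'" "y \<in> pverts H" | "x \<in> pverts H" "y = u'"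
      | "x \<in> pverts H" "y \<in> pverts H"
      by auto
    then have "theta (extend H u' (\<sigma> \<circ> h)) x y = theta ?E (?f x) (?f y)"
    proof cases
      case 1
      then show ?thesis
        by (simp add: theta_self ET tournament_extend[OF H u'])
    next
      case 2
      then have "theta ?E (?f x) (?f y) = \<sigma> (h y)"
        using ext(2)[OF h(1)] u' by auto
      then show ?thesis
        using 2 theta_extend(2)[OF H u' s', of y] by simp
    next
      case 3
      then have "theta ?E (?f x) (?f y) = - \<sigma> (h x)"
        using ext(3)[OF h(1)] u' by auto
      then show ?thesis
        using 3 theta_extend(3)[OF H u' s', of x] by simp
    next
      case 4
      then have "theta ?E (?f x) (?f y) = theta H x y"
        using ext(1)[OF h(1) h(1)] h_theta u' by auto
      then show ?thesis
        using 4 theta_extend(1)[OF H u'] by simp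
    qed
    then show "theta (extend H u' (\<sigma> \<circ> h)) x y = 1 * 1 * theta ?E (?f x) (?f y)"
      by simp
  qed simp
  ultimately obtain q \<epsilon> where q: "q \<in> pverts H" and e: "\<epsilon> \<in> {1, -1}"
    and good: "\<And>r. r \<in> pverts H \<Longrightarrow> r \<noteq> q \<Longrightarrow> \<sigma> (h r) = \<epsilon> * theta H q r"
    by (rule CR_extensionsD) auto

  \<comment> \<open>The transversal \<open>h'\<close> is arbitrary because \<open>h\<close> will be
    changed at \<open>q\<close>. The added vertex \<open>y\<close> may lie in any part: in that of
    \<open>q\<close> it competes with \<open>h' q\<close>, elsewhere \<open>h' q\<close> is the only
    candidate for \<open>v\<close>.\<close>
  have pair: "\<exists>v\<in>{h' q, y}. \<pi> v = q \<and>
      (\<forall>w\<in>insert y (h' ` pverts H) - {v}. \<sigma> w = \<epsilon> * theta B v w)"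
    if h': "\<And>p. p \<in> pverts H \<Longrightarrow> h' p \<in> pverts B" "\<And>p. p \<in> pverts H \<Longrightarrow> \<pi> (h' p) = p"
      and good': "\<And>r. r \<in> pverts H \<Longrightarrow> r \<noteq> q \<Longrightarrow> \<sigma> (h' r) = \<epsilon> * theta H q r"
      and y: "y \<in> pverts B" "y \<notin> h' ` pverts H" for h' y
  proof -
    define X where "X = insert y (h' ` pverts H)"
    have X: "X \<subseteq> pverts B" "X \<noteq> {}"
      using h' y by (auto simp: X_def)
    define C where "C = induced B X"
    have C: "tournament C" and VC: "pverts C = X"
      using tournament_induced[OF B X] by (simp_all add: C_def)
    have \<pi>C: "blowup_map H C \<pi>" and one: "one_transitive_blowup H C"
      unfolding C_def X_def by (rule one_transitive_blowup_of_section[OF H B \<pi> h' y]; assumption)+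
    have "C \<in> tclass k - tclass (k - 2)"
      using Hk by (simp add: tclass_blowup_iff[OF H C \<pi>C])
    moreover have "3 \<le> card (pverts C)"
      using card_blowup[OF C \<pi>C] card by simp
    moreover have "CR_tournament C"
      using strong one by (simp add: strong_CR_tournament_def)
    ultimately have "CR_extensions k C"
      using CR_tournament_iff[OF k] by blast
    moreover have "u \<notin> pverts C" "\<sigma> \<in> pverts C \<rightarrow> {1, -1}"
      using u \<sigma> X by (auto simp: VC)
    \<comment> \<open>\<open>C\<close> together with \<open>u\<close> is a subtournament of
      \<open>?E\<close>.\<close>
    moreover have "extend C u \<sigma> \<in> tclass k"
    proof -
      have "X \<subseteq> pverts ?E"
        using X by auto
      have "C = induced ?E X"
      proof (rule tournament_eqI[OF C])
        show "tournament (induced ?E X)"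
          using ET \<open>X \<subseteq> pverts ?E\<close> X(2) by (rule tournament_induced)
        show "theta C v w = theta (induced ?E X) v w" if "v \<in> pverts C" "w \<in> pverts C" for v w
          using that X(1) ext(1)[of v w] unfolding C_def by (simp add: theta_induced subset_iff)
      qed (simp add: VC)
      moreover have "extend (induced ?E X) u \<sigma> = induced ?E (insert u X)"
      proof (rule extend_induced[OF ET \<open>X \<subseteq> pverts ?E\<close> X(2)])
        show "\<sigma> w = theta ?E u w" if "w \<in> X" for w
          using ext(2)[of w] X(1) that by auto
      qed (use u X(1) in auto)
      moreover have "induced ?E (insert u X) \<in> tclass k"
        using X(1) by (intro tclass_induced[OF E]) auto
      ultimately show ?thesis by simp
    qed
    ultimately obtain v \<epsilon>' where v: "v \<in> X" and e': "\<epsilon>' \<in> {1, -1}"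
      and v_eq: "\<And>w. w \<in> X \<Longrightarrow> w \<noteq> v \<Longrightarrow> \<sigma> w = \<epsilon>' * theta B v w"
    proof (rule CR_extensionsD, goal_cases)
      case (1 v \<epsilon>')
      have "\<sigma> w = \<epsilon>' * theta B v w" if "w \<in> X" "w \<noteq> v" for w
        using 1(4)[of w] that 1(2) by (simp add: VC) (simp add: C_def theta_induced)
      then show ?case
        using 1(1)[of v \<epsilon>'] 1(2,3) VC by blast
    qed
    have pv: "\<pi> v \<in> pverts H"
      using v X(1) blowup_mapD(2)[OF \<pi>] by auto
    \<comment> \<open>Outside the parts of \<open>q\<close> and of \<open>v\<close>, the signs of
      \<open>u\<close> on the transversal \<open>h'\<close> are described both by \<open>q\<close>
      with \<open>\<epsilon>\<close> and by \<open>\<pi> v\<close> with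
      \<open>\<epsilon>'\<close>.\<close>
    have "q = \<pi> v \<and> \<epsilon> = \<epsilon>'"
    proof (rule basic_unique[OF basic q pv e e'])
      fix r assume r: "r \<in> pverts H" "r \<noteq> q" "r \<noteq> \<pi> v"
      have "h' r \<in> X" "h' r \<noteq> v"
        using r h'(2) by (auto simp: X_def)
      then have "\<sigma> (h' r) = \<epsilon>' * theta B v (h' r)"
        by (rule v_eq)
      also have "theta B v (h' r) = theta H (\<pi> v) (\<pi> (h' r))"
        using r v X(1) h' by (intro blowup_mapD(3)[OF \<pi>]) auto
      finally show "\<epsilon> * theta H q r = \<epsilon>' * theta H (\<pi> v) r"
        using good'[OF r(1,2)] h'(2)[OF r(1)] by simp
    qed
    moreover from this have "v \<in> {h' q, y}"
      using v h'(2) by (auto simp: X_def)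
    ultimately show ?thesis
      using v_eq unfolding X_def by blast
  qed

  let ?Q = "{x \<in> pverts B. \<pi> x = q}"
  have "\<exists>v\<in>?Q. \<forall>w\<in>?Q - {v}. \<epsilon> * \<sigma> w = theta B v w"
  proof (rule transitive_ex_neighbour[OF B])
    show "?Q \<subseteq> pverts B" "?Q \<noteq> {}"
      using h q by auto
    show "theta B x z = 1"
      if "x \<in> ?Q" "y \<in> ?Q" "z \<in> ?Q" "theta B x y = 1" "theta B y z = 1" for x y z
      using that by (intro blowup_mapD(4)[OF \<pi>, of x y z]) auto
    show "\<epsilon> * \<sigma> x = 1 \<or> \<epsilon> * \<sigma> x = -1" if "x \<in> ?Q" for x
      using e \<sigma> that by auto
    show "\<epsilon> * \<sigma> y = 1" if x: "x \<in> ?Q" and y: "y \<in> ?Q" and xy: "theta B x y = 1" "\<epsilon> * \<sigma> x = 1" for x y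
    proof -
      \<comment> \<open>Routing the transversal through \<open>x\<close> puts both \<open>x\<close>
        and \<open>y\<close> of the part of \<open>q\<close> into the 1-transitive blowup. Matching
        \<open>u\<close> with \<open>x\<close> gives the claim, while matching it with
        \<open>y\<close> would give \<open>x\<close> the opposite sign.\<close>
      let ?h = "h(q := x)"
      have ne: "x \<noteq> y"
        using xy theta_self[OF B] by auto
      have "\<exists>v\<in>{?h q, y}. \<pi> v = q \<and>
          (\<forall>w\<in>insert y (?h ` pverts H) - {v}. \<sigma> w = \<epsilon> * theta B v w)"
      proof (rule pair)
        show "y \<notin> ?h ` pverts H"
        proof
          assume "y \<in> ?h ` pverts H"
          then obtain r where "r \<in> pverts H" "y = ?h r"
            by blast
          then show False
            using h(2)[of r] y ne by (auto split: if_splits)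
        qed
      qed (use h good x y in auto)
      then consider "\<sigma> y = \<epsilon> * theta B x y" | "\<sigma> x = \<epsilon> * theta B y x"
        using ne q by auto
      then show ?thesis
        using xy e theta_antisym[OF B, of y x] by cases auto
    qed
  qed
  then obtain v where v: "v \<in> pverts B" "\<pi> v = q"
    and v_fibre: "\<And>w. w \<in> pverts B \<Longrightarrow> \<pi> w = q \<Longrightarrow> w \<noteq> v \<Longrightarrow> \<epsilon> * \<sigma> w = theta B v w"
    by blast
  have "\<sigma> w = \<epsilon> * theta B v w" if w: "w \<in> pverts B" "w \<noteq> v" for w
  proof (cases "\<pi> w = q")
    case True
    then show ?thesis
      using v_fibre[OF w(1) True w(2)] e by auto
  next
    case False
    have pw: "\<pi> w \<in> pverts H"
      using blowup_mapD(2)[OF \<pi> w(1)] .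
    have "\<sigma> w = \<epsilon> * theta H q (\<pi> w)"
    proof (cases "w \<in> h ` pverts H")
      case True
      then show ?thesis
        using good h(2) False by auto
    next
      case nin: False
      \<comment> \<open>As \<open>w\<close> lies outside the part of \<open>q\<close>, the vertex
        supplied by \<open>pair\<close> is \<open>h q\<close>.\<close>
      have "\<sigma> w = \<epsilon> * theta B (h q) w"
        using pair[OF h good w(1) nin] False h(2)[OF q] by auto
      also have "theta B (h q) w = theta H (\<pi> (h q)) (\<pi> w)"
        using False h q w by (intro blowup_mapD(3)[OF \<pi>]) auto
      finally show ?thesis
        using h(2)[OF q] by simp
    qed
    moreover have "theta B v w = theta H (\<pi> v) (\<pi> w)"
      using v w False by (intro blowup_mapD(3)[OF \<pi>]) auto
    ultimately show ?thesis
      using v by simp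
  qed
  then show "\<exists>v\<in>pverts B. \<exists>\<epsilon>\<in>{1, -1}. \<forall>w\<in>pverts B - {v}. \<sigma> w = \<epsilon> * theta B v w"
    using v(1) e by blast
qed

section \<open>Growing a switched blowup inside a tournament\<close>

text \<open>Induction on the number of vertices outside \<open>Y\<close>. The CR property of the
  blowup on \<open>Y\<close> matches a vertex \<open>u\<close> outside with some \<open>v\<close> in
  \<open>Y\<close>; after adjusting the switch at \<open>u\<close>, it joins the part of
  \<open>v\<close>.\<close>

lemma switched_blowup_grow:
  fixes T :: "'b pair_pre_digraph"
  assumes H: "tournament H" and T: "tournament T" and k: "T \<in> tclass k"
    and CR: "\<And>(B :: 'b pair_pre_digraph) \<pi>. tournament B \<Longrightarrow> blowup_map H B \<pi> \<Longrightarrow> CR_extensions k B"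
    and Y: "Y \<subseteq> pverts T" "Y \<noteq> {}" and \<pi>: "blowup_map H (induced (switch T W) Y) \<pi>"
  shows "\<exists>W \<pi>. blowup_map H (switch T W) \<pi>"
  using Y \<pi>
proof (induction "card (pverts T - Y)" arbitrary: Y W \<pi> rule: less_induct)
  case less
  note \<pi> = less.prems(3)
  define S where "S = switch T W"
  have S: "tournament S" and VS: "pverts S = pverts T"
    using tournament_switch[OF T] by (simp_all add: S_def)
  show ?case
  proof (cases "Y = pverts T")
    case True
    then have "induced S Y = S"
      using induced_all[OF S] VS by simp
    then show ?thesis
      using \<pi> unfolding S_def by metis
  next
    case False
    then obtain u where u: "u \<in> pverts T" "u \<notin> Y"
      using less.prems(1) by blast
    define B where "B = induced S Y"
    have B: "tournament B"
      unfolding B_def using S less.prems(1,2) by (intro tournament_induced) (auto simp: VS)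
    have \<pi>B: "blowup_map H B \<pi>"
      using \<pi> by (simp add: B_def S_def)
    have VB: "pverts B = Y" and theta_B: "\<And>x y. x \<in> Y \<Longrightarrow> y \<in> Y \<Longrightarrow> theta B x y = theta S x y"
      by (simp_all add: B_def theta_induced)
    have "extend B u (theta S u) = induced S (insert u Y)"
      unfolding B_def using less.prems(1,2) u by (intro extend_induced[OF S]) (auto simp: VS)
    moreover have "induced S (insert u Y) \<in> tclass k"
      using less.prems(1) u k by (intro tclass_induced) (auto simp: VS S_def tclass_switch_iff[OF T])
    moreover have "theta S u \<in> pverts B \<rightarrow> {1, -1}"
      using theta_cases[OF S, of u] u less.prems(1) by (fastforce simp: VB VS)
    moreover have "u \<notin> pverts B"
      using u by (simp add: VB)
    ultimately obtain v \<epsilon> where v: "v \<in> Y" and e: "\<epsilon> \<in> {1, -1}"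
      and v_eq: "\<And>w. w \<in> Y \<Longrightarrow> w \<noteq> v \<Longrightarrow> theta S u w = \<epsilon> * theta S v w"
      using CR_extensionsD[OF CR[OF B \<pi>B], of u "theta S u"] theta_B unfolding VB by metis
    \<comment> \<open>Toggling \<open>u\<close> in the switching set negates only the signs at
      \<open>u\<close>, which turns a revertex of \<open>v\<close> into a covertex.\<close>
    define W' where "W' = (if \<epsilon> = 1 then W else if u \<in> W then W - {u} else insert u W)"
    define S' where "S' = switch T W'"
    have S': "tournament S'"
      unfolding S'_def by (rule tournament_switch[OF T])
    have "switch_sign W' x = (if x = u then \<epsilon> else 1) * switch_sign W x" for x
      using e by (auto simp: switch_sign_def W'_def)
    then have theta_S': "theta S' x y = (if x = u then \<epsilon> else 1) * (if y = u then \<epsilon> else 1) * theta S x y" for x y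
      by (simp add: S'_def S_def theta_switch[OF T])
    have same: "theta S' x y = theta B x y" if "x \<in> Y" "y \<in> Y" for x y
      using that u theta_B by (auto simp: theta_S')
    have uw: "theta S' u w = theta S' v w" if "w \<in> Y" "w \<noteq> v" for w
    proof -
      have "w \<noteq> u" "v \<noteq> u" "\<epsilon> * \<epsilon> = 1"
        using that v u e by auto
      then show ?thesis
        using v_eq[OF that] by (simp add: theta_S' mult.assoc[symmetric])
    qed
    have wu: "theta S' w u = theta S' w v" if "w \<in> Y" "w \<noteq> v" for w
      using uw[OF that] theta_antisym[OF S', of w] by simp
    have irr: "theta S' x x \<noteq> 1" "theta S' x y = 1 \<Longrightarrow> theta S' y x \<noteq> 1" for x y
      using theta_self[OF S'] theta_antisym[OF S', of y x] by auto
    define \<rho> where "\<rho> = \<pi>(u := \<pi> v)"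
    have \<rho>: "\<rho> u = \<pi> v" "\<And>x. x \<in> Y \<Longrightarrow> \<rho> x = \<pi> x"
      using u by (auto simp: \<rho>_def)
    have cross: "theta S' x y = theta H (\<pi> x) (\<pi> y)" if "x \<in> Y" "y \<in> Y" "\<pi> x \<noteq> \<pi> y" for x y
      using that blowup_mapD(3)[OF \<pi>B, of x y] same by (simp add: VB)
    have trans: "theta S' x z = 1" if "x \<in> Y" "y \<in> Y" "z \<in> Y" "\<pi> x = \<pi> y" "\<pi> y = \<pi> z"
      "theta S' x y = 1" "theta S' y z = 1" for x y z
      using that blowup_mapD(4)[OF \<pi>B, of x y z] same by (simp add: VB)
    have "blowup_map H (induced S' (insert u Y)) \<rho>"
      unfolding blowup_map_def pverts_induced
    proof (intro conjI ballI impI)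
      show "\<rho> ` insert u Y = pverts H"
        using blowup_mapD(1)[OF \<pi>B] v \<rho> by (auto simp: VB)
      fix x y assume x: "x \<in> insert u Y" and y: "y \<in> insert u Y"
      show "theta (induced S' (insert u Y)) x y = theta H (\<rho> x) (\<rho> y)" if ne: "\<rho> x \<noteq> \<rho> y"
      proof -
        have "y \<noteq> v" if "x = u"
          using that ne \<rho> v by auto
        moreover have "x \<noteq> v" if "y = u"
          using that ne \<rho> v by auto
        ultimately consider "x \<in> Y" "y \<in> Y" | "x = u" "y \<in> Y" "y \<noteq> v" | "x \<in> Y" "x \<noteq> v" "y = u"
          using x y ne by blast
        then have "theta S' x y = theta H (\<rho> x) (\<rho> y)"
          using cross ne v \<rho> uw wu by cases auto
        then show ?thesis
          using x y by (simp add: theta_induced)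
      qed
      fix z assume z: "z \<in> insert u Y" and eq: "\<rho> x = \<rho> y" "\<rho> y = \<rho> z"
        and "theta (induced S' (insert u Y)) x y = 1" "theta (induced S' (insert u Y)) y z = 1"
      then have xy: "theta S' x y = 1" and yz: "theta S' y z = 1"
        using x y by (simp_all add: theta_induced)
      \<comment> \<open>If \<open>u\<close> occurred twice, an arc would be a loop or the two arcs
        would be opposite. A single \<open>u\<close> is replaced by its covertex \<open>v\<close> in
        the transitivity of the old part.\<close>
      consider "x \<in> Y" "y \<in> Y" "z \<in> Y" | "x = u" "y \<in> Y" "z \<in> Y" | "x \<in> Y" "y = u" "z \<in> Y"
        | "x \<in> Y" "y \<in> Y" "z = u"
        using x y z xy yz irr by blast
      then have "theta S' x z = 1"
      proof cases
        case 1
        then show ?thesis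
          using trans[of x y z] eq xy yz \<rho> by simp
      next
        case 2
        then show ?thesis
          using trans[of v y z] eq xy yz \<rho> uw[of y] uw[of z] v irr by (metis (full_types))
      next
        case 3
        then show ?thesis
          using trans[of x v z] eq xy yz \<rho> wu[of x] uw[of z] v irr by (metis (full_types))
      next
        case 4
        then show ?thesis
          using trans[of x y v] eq xy yz \<rho> wu[of x] wu[of y] v irr by (metis (full_types))
      qed
      then show "theta (induced S' (insert u Y)) x z = 1"
        using x z by (simp add: theta_induced)
    qed
    moreover have "card (pverts T - insert u Y) < card (pverts T - Y)"
      using u tournament_finite[OF T] by (intro psubset_card_mono) auto
    ultimately show ?thesis
      using less.hyps[of "insert u Y" W' \<rho>] less.prems(1) u unfolding S'_def by auto
  qed
qed

section \<open>From the characterization back to CR blowups\<close>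

lemma CR_extensions_of_characterization:
  fixes B :: "'b pair_pre_digraph"
  assumes basic: "basic H" and Hk: "H \<in> tclass k - tclass l"
    and char: "\<And>T :: 'b pair_pre_digraph. tournament T \<Longrightarrow> T \<in> xi H \<Longrightarrow> T \<in> tclass k - tclass l \<Longrightarrow>
      \<exists>W \<pi>. blowup_map H (switch T W) \<pi>"
    and B: "tournament B" and \<pi>: "blowup_map H B \<pi>"
  shows "CR_extensions k B"
  unfolding CR_extensions_def
proof (intro allI impI)
  fix u and \<sigma> :: "_ \<Rightarrow> int"
  assume u: "u \<notin> pverts B" and \<sigma>: "\<sigma> \<in> pverts B \<rightarrow> {1, -1}" and E: "extend B u \<sigma> \<in> tclass k"
  have H: "tournament H"
    using basic by (simp add: basic_def)
  let ?E = "extend B u \<sigma>"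
  have ET: "tournament ?E"
    using B u by (rule tournament_extend)
  note ext = theta_extend(1)[OF B u] theta_extend(2,3)[OF B u \<sigma>]
  have B_eq: "induced ?E (pverts B) = B"
  proof (rule tournament_eqI[OF _ B])
    show "tournament (induced ?E (pverts B))"
      using tournament_nonempty[OF B] by (intro tournament_induced[OF ET]) auto
  qed (use ext in \<open>simp_all add: theta_induced\<close>)
  have "?E \<in> xi H"
    unfolding xi_iff[OF H ET] using tournament_nonempty[OF B] \<pi>
    by (intro exI[of _ "pverts B"] exI[of _ "{}"] exI[of _ \<pi>]) (auto simp: switch_empty B_eq)
  \<comment> \<open>The class is hereditary, so \<open>?E\<close> in it would put \<open>B\<close>,
    and with it \<open>H\<close>, into \<open>tclass l\<close>.\<close>
  moreover have "?E \<notin> tclass l"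
  proof
    assume "?E \<in> tclass l"
    then have "B \<in> tclass l"
      using tclass_induced[of ?E l "pverts B"] tournament_nonempty[OF B] by (auto simp: B_eq)
    then show False
      using Hk tclass_blowup_iff[OF H B \<pi>] by simp
  qed
  ultimately obtain W \<rho> where \<rho>: "blowup_map H (switch ?E W) \<rho>"
    using char[OF ET] E by blast
  define S where "S = switch ?E W"
  have S: "tournament S" and VS: "pverts S = insert u (pverts B)"
    using tournament_switch[OF ET] by (simp_all add: S_def)
  let ?s = "switch_sign W"
  have theta_S: "theta ?E x y = ?s x * ?s y * theta S x y" for x y
    by (auto simp: S_def theta_switch[OF ET] switch_sign_def)
  have \<rho>S: "blowup_map H S \<rho>"
    using \<rho> by (simp add: S_def)
  have scale: "theta ?E x w = (?s x * ?s z) * theta ?E z w" if "theta S x w = theta S z w" for x z w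
    using that by (auto simp: theta_S switch_sign_def)
  have sign: "?s x * ?s z \<in> {1, -1}" for x z
    by (auto simp: switch_sign_def)
  show "\<exists>v\<in>pverts B. \<exists>\<epsilon>\<in>{1, -1}. \<forall>w\<in>pverts B - {v}. \<sigma> w = \<epsilon> * theta B v w"
  proof (cases "\<exists>y\<in>pverts B. \<rho> y = \<rho> u")
    case True
    then obtain y where "y \<in> pverts B" "\<rho> y = \<rho> u"
      by blast
    then have "y \<in> pverts S" "u \<in> pverts S" "u \<noteq> y" "\<rho> u = \<rho> y"
      using u by (auto simp: VS)
    then obtain z where z: "z \<in> pverts S" "z \<noteq> u"
      "\<And>w. w \<in> pverts S \<Longrightarrow> w \<noteq> u \<Longrightarrow> w \<noteq> z \<Longrightarrow> theta S u w = theta S z w"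
      using blowup_map_ex_covertex[OF S \<rho>S subset_refl, of u y] by metis
    have zB: "z \<in> pverts B"
      using z by (simp add: VS)
    \<comment> \<open>Undoing the switch turns the covertex \<open>z\<close> of \<open>u\<close>
      into a CR-associated vertex; the sign is the product of the switching signs of the
      two.\<close>
    have "\<sigma> w = (?s u * ?s z) * theta B z w" if "w \<in> pverts B - {z}" for w
    proof -
      have "theta S u w = theta S z w"
        using that u by (intro z(3)) (auto simp: VS)
      then show ?thesis
        using scale[of u w z] ext(1)[OF zB, of w] ext(2)[of w] that by simp
    qed
    then show ?thesis
      using zB sign by blast
  next
    case False
    obtain h where h: "\<forall>p\<in>pverts H. h p \<in> pverts B" "inj_on h (pverts H)"
      "\<forall>p\<in>pverts H. \<forall>q\<in>pverts H. theta B (h p) (h q) = theta H p q"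
      using blowup_map_section[OF H B \<pi>] by blast
    let ?X = "h ` pverts H"
    have X: "?X \<subseteq> pverts B" "?X \<subseteq> pverts S"
      using h(1) by (auto simp: VS)
    \<comment> \<open>Here \<open>u\<close> is alone in its part, so the copy \<open>?X\<close> of
      \<open>H\<close> in \<open>B\<close> misses that part and has more vertices than parts to
      meet.\<close>
    have "\<rho> ` ?X \<subseteq> pverts H - {\<rho> u}"
    proof (rule image_subsetI)
      fix x assume "x \<in> ?X"
      then have "x \<in> pverts B" "x \<in> pverts S"
        using X by blast+
      then show "\<rho> x \<in> pverts H - {\<rho> u}"
        using False blowup_mapD(2)[OF \<rho>S] by simp
    qed
    moreover have "\<rho> u \<in> pverts H"
      using blowup_mapD(2)[OF \<rho>S] by (simp add: VS)
    ultimately have "card (\<rho> ` ?X) < card (pverts H)"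
      using tournament_finite[OF H] by (intro psubset_card_mono) blast+
    then have "card (\<rho> ` ?X) < card ?X"
      using card_image[OF h(2)] by simp
    then have "\<not> inj_on \<rho> ?X"
      by (rule pigeonhole)
    then obtain x y where xy: "x \<in> ?X" "y \<in> ?X" "x \<noteq> y" "\<rho> x = \<rho> y"
      unfolding inj_on_def by blast
    then obtain z where z: "z \<in> ?X" "z \<noteq> x"
      "\<And>w. w \<in> ?X \<Longrightarrow> w \<noteq> x \<Longrightarrow> w \<noteq> z \<Longrightarrow> theta S x w = theta S z w"
      using blowup_map_ex_covertex[OF S \<rho>S X(2), of x y] by metis
    obtain p q where pq: "p \<in> pverts H" "q \<in> pverts H" "x = h p" "z = h q"
      using xy(1) z(1) by blast
    \<comment> \<open>Covertices in the switch are CR-associated before it, so two vertices of the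
      copy of \<open>H\<close> violate basicness; the contradiction takes the form
      \<open>p = q\<close> against \<open>z \<noteq> x\<close>.\<close>
    have "p = q \<and> 1 = ?s x * ?s z"
    proof (rule basic_unique[OF basic pq(1,2) _ sign])
      fix r assume r: "r \<in> pverts H" "r \<noteq> p" "r \<noteq> q"
      then have "h r \<noteq> x" "h r \<noteq> z"
        using h(2) pq by (auto dest: inj_onD)
      then have "theta S x (h r) = theta S z (h r)"
        using r by (intro z(3)) auto
      then have "theta ?E x (h r) = (?s x * ?s z) * theta ?E z (h r)"
        by (rule scale)
      then show "1 * theta H p r = ?s x * ?s z * theta H q r"
        using ext(1) h(1,3) pq r by simp
    qed simp
    then show ?thesis
      using pq z(2) by simp
  qed
qed

theorem theorem5p1:
  fixes H :: "'a::infinite pair_pre_digraph" and k :: int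
  assumes "odd k" and "3 \<le> k"
    and "H \<in> tclass k - tclass (k - 2)"
    and "basic H"
  shows "(strong_CR_tournament H \<longleftrightarrow>
            (\<forall>B :: 'a pair_pre_digraph. transitive_blowup H B \<longrightarrow> CR_tournament B)) \<and>
         ((\<forall>B :: 'a pair_pre_digraph. transitive_blowup H B \<longrightarrow> CR_tournament B) \<longleftrightarrow>
            (\<forall>T :: 'a pair_pre_digraph. tournament T \<longrightarrow>
               (T \<in> xi H \<inter> (tclass k - tclass (k - 2)) \<longleftrightarrow>
                switching_equiv_transitive_blowup T H)))"
proof -
  note k = assms(1) and Hk = assms(3) and basic = assms(4)
  have H: "tournament H" and card: "4 \<le> card (pverts H)"
    using basic by (auto simp: basic_def)
  have CR_iff: "CR_tournament B \<longleftrightarrow> CR_extensions k B"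
    if "tournament B" "blowup_map H B \<pi>" for B :: "'a pair_pre_digraph" and \<pi>
    using that Hk card card_blowup[OF that] tclass_blowup_iff[OF H that]
    by (intro CR_tournament_iff[OF k]) auto
  \<comment> \<open>The second assertion in terms of blowup maps; the other two are compared with
    this form.\<close>
  define CR_blowups where "CR_blowups \<longleftrightarrow>
    (\<forall>(B :: 'a pair_pre_digraph) \<pi>. tournament B \<longrightarrow> blowup_map H B \<pi> \<longrightarrow> CR_extensions k B)"
  have ii: "(\<forall>B :: 'a pair_pre_digraph. transitive_blowup H B \<longrightarrow> CR_tournament B) \<longleftrightarrow> CR_blowups"
    unfolding CR_blowups_def transitive_blowup_iff[OF H] using CR_iff by blast
  have "strong_CR_tournament H \<longleftrightarrow> CR_blowups"
  proof
    show CR_blowups if "strong_CR_tournament H"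
      unfolding CR_blowups_def using strong_CR_blowup[OF k Hk basic that] by blast
    assume CR_blowups
    moreover have "transitive_blowup H H"
      using transitive_blowup_iff[OF H] H blowup_map_id[OF H] by blast
    moreover have "transitive_blowup H B" if "one_transitive_blowup H B" for B :: "'a pair_pre_digraph"
      using that unfolding transitive_blowup_def one_transitive_blowup_def by blast
    ultimately show "strong_CR_tournament H"
      using ii unfolding strong_CR_tournament_def by blast
  qed
  moreover have in_xi: "T \<in> xi H \<inter> (tclass k - tclass (k - 2))"
    if T: "tournament T" and \<pi>: "blowup_map H (switch T W) \<pi>" for T :: "'a pair_pre_digraph" and W \<pi>
  proof -
    have S: "tournament (switch T W)"
      by (rule tournament_switch[OF T])
    have "T \<in> xi H"
      unfolding xi_iff[OF H T] using \<pi> tournament_nonempty[OF T] induced_all[OF S]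
      by (intro exI[of _ "pverts T"] exI[of _ W] exI[of _ \<pi>]) simp
    \<comment> \<open>The equivalence holds for every index, so it transfers both membership at
      \<open>k\<close> and non-membership at \<open>k - 2\<close>.\<close>
    moreover have "T \<in> tclass l \<longleftrightarrow> H \<in> tclass l" for l
      using tclass_switch_iff[OF T] tclass_blowup_iff[OF H S \<pi>] by blast
    ultimately show ?thesis
      using Hk by blast
  qed
  have "CR_blowups \<longleftrightarrow> (\<forall>T :: 'a pair_pre_digraph. tournament T \<longrightarrow>
      (T \<in> xi H \<inter> (tclass k - tclass (k - 2)) \<longleftrightarrow> switching_equiv_transitive_blowup T H))"
  proof
    assume CR: CR_blowups
    show "\<forall>T :: 'a pair_pre_digraph. tournament T \<longrightarrow>
      (T \<in> xi H \<inter> (tclass k - tclass (k - 2)) \<longleftrightarrow> switching_equiv_transitive_blowup T H)"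
    proof (intro allI impI iffI)
      fix T :: "'a pair_pre_digraph"
      assume T: "tournament T"
      show "T \<in> xi H \<inter> (tclass k - tclass (k - 2))" if "switching_equiv_transitive_blowup T H"
        using that switching_equiv_transitive_blowup_iff[OF T H] in_xi[OF T] by blast
      assume Tk: "T \<in> xi H \<inter> (tclass k - tclass (k - 2))"
      then obtain X W \<pi> where X: "X \<subseteq> pverts T" "X \<noteq> {}" "blowup_map H (induced (switch T W) X) \<pi>"
        using xi_iff[OF H T] by blast
      have "\<exists>W \<pi>. blowup_map H (switch T W) \<pi>"
        by (rule switched_blowup_grow[OF H T _ _ X]) (use Tk CR in \<open>auto simp: CR_blowups_def\<close>)
      then show "switching_equiv_transitive_blowup T H"
        using switching_equiv_transitive_blowup_iff[OF T H] by blast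
    qed
  next
    assume iii: "\<forall>T :: 'a pair_pre_digraph. tournament T \<longrightarrow>
      (T \<in> xi H \<inter> (tclass k - tclass (k - 2)) \<longleftrightarrow> switching_equiv_transitive_blowup T H)"
    show CR_blowups
      unfolding CR_blowups_def
    proof (intro allI impI)
      fix B :: "'a pair_pre_digraph" and \<pi>
      assume "tournament B" "blowup_map H B \<pi>"
      then show "CR_extensions k B"
        using iii switching_equiv_transitive_blowup_iff[OF _ H]
        by (intro CR_extensions_of_characterization[OF basic Hk]) blast+
    qed
  qed
  ultimately show ?thesis
    unfolding ii by blast
qed

end
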